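(* Let $$A=3189762509404991434026267111935081578564848099075598418737381122$$ and $$B=1464481329052452484012410951111069258728979724777952402192519099.$$ The arithmetic progression $Am+B$, where $m$ ranges over the nonnegative integers, contains infinitely many primes that are Riesel numbers.
   Context: A Riesel number is a positive odd integer $k$ such that $k\cdot 2^n-1$ is composite for all nonnegative integers $n$. *)

theory Defs
  imports "HOL-Computational_Algebra.Primes"
begin

definition composite :: "nat \<Rightarrow> bool" where
  "composite n \<longleftrightarrow> n > 1 \<and> \<not> prime n"

text \<open>The truncated subtraction on natural numbers is harmless below, since
  \<open>k * 2 ^ n \<ge> 1\<close> for positive \<open>k\<close>.\<close>

definition riesel :: "nat \<Rightarrow> bool" where
  "riesel k \<longleftrightarrow> k > 0 \<and> odd k \<and> (\<forall>n::nat. composite (k * 2 ^ n - 1))"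

end

theory Submission
  imports Defs "HOL-Analysis.Analysis" "HOL-Number_Theory.Number_Theory"
begin

unbundle no vec_syntax

text \<open>
  Sixteen congruence classes of exponents cover all \<open>n\<close>, and to each of them belongs a divisor
  \<open>d\<close> of \<open>A\<close> such that \<open>d\<close> divides \<open>k * 2 ^ n - 1\<close> for all \<open>n\<close> in the class and all
  \<open>k \<equiv> B\<close> modulo \<open>A\<close>. As \<open>A\<close> and \<open>B\<close> are coprime, what remains is Dirichlet's theorem.

  Dirichlet's theorem is obtained from the behaviour of the L-series \<open>L(s)\<close> as the real variable
  \<open>s\<close> decreases to \<open>1\<close>. From \<open>L(s) \<Sum> \<chi>(n) \<Lambda>(n) n\<^sup>-\<^sup>s = - L'(s)\<close> and \<open>L(1) \<noteq> 0\<close> the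
  logarithmic derivative of a nonprincipal L-series is bounded, that of the principal one is not, and
  orthogonality of characters isolates a residue class. If \<open>L(1) = 0\<close> for some nonprincipal
  character, then this character is real, because the product of all L-series is bounded away
  from \<open>0\<close>. Real characters are dealt with by Monsky's argument: if \<open>\<Sum> \<chi>(n) / n = 0\<close>, then the
  Lambert series \<open>\<Sum> \<chi>(n) t\<^sup>n / (1 - t\<^sup>n)\<close> is bounded on \<open>(0, 1)\<close> by partial summation, although
  its power series coefficients are nonnegative, and at least \<open>1\<close> at infinitely many places.
\<close>

section \<open>Dirichlet characters\<close>

text \<open>Characters of the unit group modulo \<open>N\<close>, pulled back to the naturals and
  extended by \<open>0\<close>. Fixing the support makes each of them a single function, so that
  sums and products over the set of all characters make sense.\<close>

definition dirichlet_character :: "nat \<Rightarrow> (nat \<Rightarrow> complex) \<Rightarrow> bool" where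
  "dirichlet_character N \<chi> \<longleftrightarrow>
     (\<forall>a b. \<chi> (a * b) = \<chi> a * \<chi> b) \<and> (\<forall>a. \<chi> (a mod N) = \<chi> a) \<and>
     (\<forall>a. \<chi> a = 0 \<longleftrightarrow> \<not> coprime a N)"

context
  fixes N :: nat and \<chi> :: "nat \<Rightarrow> complex"
  assumes chi: "dirichlet_character N \<chi>"
begin

lemma dirichlet_character_mult: "\<chi> (a * b) = \<chi> a * \<chi> b"
  using chi by (simp add: dirichlet_character_def)

lemma dirichlet_character_mod: "\<chi> (a mod N) = \<chi> a"
  using chi by (simp add: dirichlet_character_def)

lemma dirichlet_character_cong: "[a = b] (mod N) \<Longrightarrow> \<chi> a = \<chi> b"
  using dirichlet_character_mod by (metis cong_def)

lemma dirichlet_character_eq_0_iff: "\<chi> a = 0 \<longleftrightarrow> \<not> coprime a N"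
  using chi by (simp add: dirichlet_character_def)

lemma dirichlet_character_1: "\<chi> 1 = 1"
  using dirichlet_character_mult[of 1 1] dirichlet_character_eq_0_iff[of 1] by simp

lemma dirichlet_character_Suc_0: "\<chi> (Suc 0) = 1"
  using dirichlet_character_1 by simp

lemma dirichlet_character_power: "\<chi> (a ^ k) = \<chi> a ^ k"
  by (induction k) (auto simp: dirichlet_character_mult dirichlet_character_Suc_0)

lemma dirichlet_character_power_totient:
  assumes "coprime a N"
  shows "\<chi> a ^ totient N = 1"
proof -
  have "[a ^ totient N = 1] (mod N)"
    using assms by (rule euler_theorem)
  from dirichlet_character_cong[OF this] show ?thesis
    by (simp add: dirichlet_character_power dirichlet_character_Suc_0)
qed

text \<open>At a unit, Euler's theorem makes the value a root of unity.\<close>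

lemma norm_dirichlet_character:
  assumes "N > 0"
  shows "norm (\<chi> a) = of_bool (coprime a N)"
proof (cases "coprime a N")
  case True
  have "norm (\<chi> a) ^ totient N = 1"
    using dirichlet_character_power_totient[OF True] by (metis norm_one norm_power)
  moreover have "totient N > 0"
    using assms by simp
  ultimately have "norm (\<chi> a) = 1"
    by (metis norm_ge_zero power_eq_1_iff real_norm_def abs_of_nonneg not_gr_zero)
  thus ?thesis using True by simp
qed (use dirichlet_character_eq_0_iff in auto)

lemma norm_dirichlet_character_le: "N > 0 \<Longrightarrow> norm (\<chi> a) \<le> 1"
  by (simp add: norm_dirichlet_character)

lemma dirichlet_character_cnj: "dirichlet_character N (\<lambda>a. cnj (\<chi> a))"
  using chi by (simp add: dirichlet_character_def)

lemma dirichlet_character_times: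
  "dirichlet_character N \<psi> \<Longrightarrow> dirichlet_character N (\<lambda>a. \<chi> a * \<psi> a)"
  using chi by (simp add: dirichlet_character_def)

end

lemma dirichlet_character_principal: "dirichlet_character N (\<lambda>a. of_bool (coprime a N))"
  by (cases "N = 0") (auto simp: dirichlet_character_def)

text \<open>A character is determined by its values on \<open>{..<N}\<close>, and each value is
  \<open>0\<close> or a root of unity of order dividing \<open>totient N\<close>.\<close>

lemma finite_dirichlet_characters:
  assumes "N > 0"
  shows "finite {\<chi>. dirichlet_character N \<chi>}"
proof (rule finite_subset)
  define W where "W = insert 0 {z :: complex. z ^ totient N = 1}"
  have "totient N > 0"
    using assms by simp
  hence "finite {z :: complex. z ^ totient N = 1}"
    by (intro finite_roots_unity) linarith
  hence "finite W"
    by (simp add: W_def)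
  thus "finite ((\<lambda>f a. f (a mod N)) ` ({..<N} \<rightarrow>\<^sub>E W))"
    by (intro finite_imageI finite_PiE) auto
  show "{\<chi>. dirichlet_character N \<chi>} \<subseteq> (\<lambda>f a. f (a mod N)) ` ({..<N} \<rightarrow>\<^sub>E W)"
  proof
    fix \<chi> assume "\<chi> \<in> {\<chi>. dirichlet_character N \<chi>}"
    hence \<chi>: "dirichlet_character N \<chi>"
      by simp
    have "restrict \<chi> {..<N} \<in> {..<N} \<rightarrow>\<^sub>E W"
      using dirichlet_character_power_totient[OF \<chi>] dirichlet_character_eq_0_iff[OF \<chi>]
      by (auto simp: W_def)
    moreover have "\<chi> = (\<lambda>a. restrict \<chi> {..<N} (a mod N))"
      using assms by (auto simp: dirichlet_character_mod[OF \<chi>])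
    ultimately show "\<chi> \<in> (\<lambda>f a. f (a mod N)) ` ({..<N} \<rightarrow>\<^sub>E W)"
      by blast
  qed
qed

text \<open>A geometric-sum projection onto an eigenspace of the translation by \<open>g\<close>. The polynomial
  \<open>\<Sum>j<k. f (g ^ j) * z ^ j\<close> has degree less than \<open>k\<close> and is nonzero because \<open>f 1 \<noteq> 0\<close>, so it
  cannot vanish at all \<open>k\<close>-th roots of unity.\<close>

lemma translation_eigenvector_step:
  fixes f :: "nat \<Rightarrow> complex"
  assumes "N > 0" "coprime g N" and per: "\<And>y. f (y mod N) = f y" and "f 1 \<noteq> 0"
  obtains w :: complex where "w ^ totient N = 1" "(\<Sum>j<totient N. w ^ j * f (g ^ j)) \<noteq> 0"
    "\<And>y. (\<Sum>j<totient N. w ^ j * f (g ^ j * (g * y))) =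
          inverse w * (\<Sum>j<totient N. w ^ j * f (g ^ j * y))"
proof -
  define k where "k = totient N"
  have k: "k > 0"
    using assms by (simp add: k_def)
  have cong: "[g ^ k = 1] (mod N)"
    unfolding k_def using assms by (intro euler_theorem)
  have "\<exists>w. w ^ k = 1 \<and> (\<Sum>j<k. w ^ j * f (g ^ j)) \<noteq> 0"
  proof (rule ccontr)
    assume contra: "\<not> ?thesis"
    have "f (g ^ 0) \<noteq> 0"
      using assms by simp
    hence *: "finite {z. (\<Sum>j\<le>k-1. f (g ^ j) * z ^ j) = 0} \<and>
              card {z. (\<Sum>j\<le>k-1. f (g ^ j) * z ^ j) = 0} \<le> k - 1"
      using polyfun_roots_finite[of "\<lambda>j. f (g ^ j)" 0 "k-1"]
        polyfun_roots_card[of "\<lambda>j. f (g ^ j)" 0 "k-1"] by auto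
    have "{..k-1} = {..<k}"
      using k by auto
    hence "{z. z ^ k = 1} \<subseteq> {z. (\<Sum>j\<le>k-1. f (g ^ j) * z ^ j) = 0}"
      using contra by (auto simp: mult.commute)
    hence "card {z :: complex. z ^ k = 1} \<le> k - 1"
      using * by (meson card_mono le_trans)
    moreover have "card {z :: complex. z ^ k = 1} = k"
      using k by (intro card_roots_unity_eq)
    ultimately show False
      using k by simp
  qed
  then obtain w where w: "w ^ k = 1" "(\<Sum>j<k. w ^ j * f (g ^ j)) \<noteq> 0"
    by blast
  have "w \<noteq> 0"
    using w k by (metis power_eq_0_iff zero_neq_one)
  have "(\<Sum>j<k. w ^ j * f (g ^ j * (g * y))) = inverse w * (\<Sum>j<k. w ^ j * f (g ^ j * y))" for y
  proof -
    \<comment> \<open>The term at index \<open>k\<close> equals the one at \<open>0\<close>, because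
      \<open>w ^ k = 1\<close> and \<open>f\<close> is periodic; hence an index shift leaves the
      cyclic sum unchanged.\<close>
    have "[g ^ k * y = 1 * y] (mod N)"
      using cong by (rule cong_scalar_right)
    hence "f (g ^ k * y) = f y"
      using per by (metis cong_def mult_1)
    hence shift: "(\<Sum>j<k. w ^ Suc j * f (g ^ Suc j * y)) = (\<Sum>j<k. w ^ j * f (g ^ j * y))"
      using sum.lessThan_Suc_shift[of "\<lambda>j. w ^ j * f (g ^ j * y)" k] w by simp
    have "w * (\<Sum>j<k. w ^ j * f (g ^ j * (g * y))) = (\<Sum>j<k. w ^ Suc j * f (g ^ Suc j * y))"
      by (simp add: sum_distrib_left mult_ac)
    with shift show ?thesis
      using \<open>w \<noteq> 0\<close> by (simp add: field_simps)
  qed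
  with w that show ?thesis
    unfolding k_def by blast
qed

text \<open>The character is a common eigenvector of all translations, obtained by repeated projection from
  an eigenvector of the translation by \<open>a\<close> whose eigenvalue is not \<open>1\<close>.\<close>

lemma exists_dirichlet_character_neq_1:
  assumes "N > 0" "coprime a N" "\<not> [a = 1] (mod N)"
  obtains \<chi> where "dirichlet_character N \<chi>" "\<chi> a \<noteq> 1"
proof -
  define k where "k = totient N"
  have cong: "[g ^ k = 1] (mod N)" if "coprime g N" for g
    unfolding k_def using that by (intro euler_theorem)
  \<comment> \<open>The condition \<open>f 1 \<noteq> 0\<close> has to survive every projection; it
    allows normalising at the end.\<close>
  define V where "V = {f :: nat \<Rightarrow> complex. (\<forall>y. f (y mod N) = f y) \<and>
    (\<forall>y. \<not> coprime y N \<longrightarrow> f y = 0) \<and> f 1 \<noteq> 0}"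
  have V_step: "(\<lambda>y. \<Sum>j<k. w ^ j * f (g ^ j * y)) \<in> V"
    if "f \<in> V" "coprime g N" "(\<Sum>j<k. w ^ j * f (g ^ j)) \<noteq> 0" for f w g
  proof -
    have "f (g ^ j * (y mod N)) = f (g ^ j * y)" for j y
      using that(1) unfolding V_def by (metis (mono_tags, lifting) mem_Collect_eq mod_mult_right_eq)
    moreover have "f (g ^ j * y) = 0" if "\<not> coprime y N" for j y
      using that \<open>f \<in> V\<close> by (auto simp: V_def)
    ultimately show ?thesis
      using that by (simp add: V_def)
  qed

  define \<delta> :: "nat \<Rightarrow> complex" where "\<delta> = (\<lambda>x. of_bool ([x = 1] (mod N)))"
  \<comment> \<open>Subtracting the translate removes the eigenvalue \<open>1\<close>: for
    \<open>w0 = 1\<close> the projection evaluated at \<open>1\<close> telescopes to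
    \<open>\<delta> 1 - \<delta> (a ^ k) = 0\<close>, so a nonzero projection has
    \<open>w0 \<noteq> 1\<close>.\<close>
  define f0 where "f0 = (\<lambda>x. \<delta> x - \<delta> (a * x))"
  have \<delta>_cong: "\<delta> x = \<delta> y" if "[x = y] (mod N)" for x y
    using that by (auto simp: \<delta>_def cong_def)
  have \<delta>_cop: "\<delta> x = 0" if "\<not> coprime x N" for x
    using that cong_imp_coprime[of 1 x N] cong_sym by (auto simp: \<delta>_def)
  have f0: "f0 \<in> V"
  proof -
    have "f0 1 = 1"
      using assms by (simp add: f0_def \<delta>_def)
    moreover have "f0 (y mod N) = f0 y" for y
      unfolding f0_def by (intro arg_cong2[where f = minus] \<delta>_cong) (auto simp: cong_def mod_mult_right_eq)
    moreover have "f0 y = 0" if "\<not> coprime y N" for y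
      using that by (simp add: f0_def \<delta>_cop)
    ultimately show ?thesis
      by (simp add: V_def)
  qed
  obtain w0 where w0: "w0 ^ k = 1" "(\<Sum>j<k. w0 ^ j * f0 (a ^ j)) \<noteq> 0"
    "\<And>y. (\<Sum>j<k. w0 ^ j * f0 (a ^ j * (a * y))) = inverse w0 * (\<Sum>j<k. w0 ^ j * f0 (a ^ j * y))"
    using translation_eigenvector_step[of N a f0] f0 assms unfolding V_def k_def by blast
  have "w0 \<noteq> 1"
  proof
    assume "w0 = 1"
    hence "(\<Sum>j<k. w0 ^ j * f0 (a ^ j)) = (\<Sum>j<k. \<delta> (a ^ j) - \<delta> (a ^ Suc j))"
      by (simp add: f0_def)
    also have "\<dots> = \<delta> 1 - \<delta> (a ^ k)"
      by (subst sum_lessThan_telescope') simp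
    also have "\<dots> = 0"
      using \<delta>_cong[OF cong[OF assms(2)]] by simp
    finally show False
      using w0 by simp
  qed
  define P where "P = (\<lambda>f. f \<in> V \<and> (\<forall>y. f (a * y) = inverse w0 * f y))"
  have P: "\<exists>f. P f \<and> (\<forall>g\<in>S. \<exists>c. \<forall>y. f (g * y) = c * f y)"
    if "finite S" "\<forall>g\<in>S. coprime g N" for S
    using that
  proof (induction rule: finite_induct)
    case empty
    have "P (\<lambda>y. \<Sum>j<k. w0 ^ j * f0 (a ^ j * y))"
      unfolding P_def using V_step[OF f0 assms(2)] w0 by blast
    thus ?case by blast
  next
    case (insert h S)
    then obtain f where f: "P f" "\<forall>g\<in>S. \<exists>c. \<forall>y. f (g * y) = c * f y"
      by auto
    obtain w where w: "w ^ k = 1" "(\<Sum>j<k. w ^ j * f (h ^ j)) \<noteq> 0"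
      "\<And>y. (\<Sum>j<k. w ^ j * f (h ^ j * (h * y))) = inverse w * (\<Sum>j<k. w ^ j * f (h ^ j * y))"
      using translation_eigenvector_step[of N h f] f insert.prems assms
      unfolding V_def P_def k_def by blast
    define f' where "f' = (\<lambda>y. \<Sum>j<k. w ^ j * f (h ^ j * y))"
    \<comment> \<open>Translations commute, so projecting along \<open>h\<close> preserves every
      eigenvalue obtained before.\<close>
    have keep: "f' (b * y) = c * f' y" if *: "\<forall>y. f (b * y) = c * f y" for b c y
    proof -
      have "f (h ^ j * (b * y)) = c * f (h ^ j * y)" for j
        using * by (metis mult.left_commute)
      thus ?thesis
        by (simp add: f'_def sum_distrib_left mult_ac)
    qed
    have "P f'"
      using V_step[of f h w] f insert.prems w keep unfolding P_def f'_def by blast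
    moreover have "\<exists>c. \<forall>y. f' (g * y) = c * f' y" if "g \<in> insert h S" for g
      using that f keep w(3) unfolding f'_def by blast
    ultimately show ?case by blast
  qed
  have "finite {g. g < N \<and> coprime g N}"
    by simp
  from P[OF this] obtain f where f: "P f" "\<And>g. g < N \<Longrightarrow> coprime g N \<Longrightarrow> \<exists>c. \<forall>y. f (g * y) = c * f y"
    by auto
  have fV: "f 1 \<noteq> 0" "\<And>y. f (y mod N) = f y" "\<And>y. \<not> coprime y N \<Longrightarrow> f y = 0"
    and fa: "\<And>y. f (a * y) = inverse w0 * f y"
    using f(1) by (auto simp: P_def V_def)
  define \<chi> where "\<chi> = (\<lambda>y. f y / f 1)"
  \<comment> \<open>Evaluating \<open>f (g * y) = c * f y\<close> at \<open>y = 1\<close> identifies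
    the eigenvalue as \<open>c = f g / f 1\<close>.\<close>
  have mult: "f (g * y) * f 1 = f g * f y" for g y
  proof (cases "coprime g N")
    case True
    have "g mod N < N" "coprime (g mod N) N"
      using assms True by auto
    then obtain c where c: "\<forall>y. f (g mod N * y) = c * f y"
      using f(2) by blast
    have c': "f (g * y) = c * f y" for y
      using c fV(2) by (metis mod_mult_left_eq)
    show ?thesis
      using c'[of y] c'[of 1] by simp
  qed (use fV in auto)
  have mult': "\<chi> (g * y) = \<chi> g * \<chi> y" for g y
    using mult[of g y] fV(1) by (simp add: \<chi>_def field_simps)
  have mod: "\<chi> (y mod N) = \<chi> y" for y
    using fV by (simp add: \<chi>_def)
  have "\<chi> y \<noteq> 0" if "coprime y N" for y
  proof
    assume "\<chi> y = 0"
    have "k > 0"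
      using assms by (simp add: k_def)
    hence "\<chi> (y ^ k) = 0"
      using \<open>\<chi> y = 0\<close> by (cases k) (auto simp: mult')
    moreover have "\<chi> (y ^ k) = \<chi> 1"
      using cong[OF that] mod by (metis cong_def)
    ultimately show False
      using fV by (simp add: \<chi>_def)
  qed
  moreover have "\<chi> y = 0" if "\<not> coprime y N" for y
    using fV(3)[OF that] by (simp add: \<chi>_def)
  ultimately have "dirichlet_character N \<chi>"
    using mult' mod by (auto simp: dirichlet_character_def)
  moreover have "\<chi> a \<noteq> 1"
    using fa[of 1] fV \<open>w0 \<noteq> 1\<close> by (simp add: \<chi>_def)
  ultimately show ?thesis
    by (rule that)
qed

text \<open>Multiplication by a character \<open>\<psi>\<close> with
  \<open>\<psi> a \<noteq> 1\<close> permutes the characters and multiplies the sum by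
  \<open>\<psi> a\<close>. The number of characters enters later estimates as a constant factor only
  and is left as \<open>card\<close>.\<close>

lemma sum_dirichlet_characters:
  assumes "N > 0"
  shows "(\<Sum>\<chi> | dirichlet_character N \<chi>. \<chi> a) =
    (if [a = 1] (mod N) then of_nat (card {\<chi>. dirichlet_character N \<chi>}) else 0)"
proof -
  let ?X = "{\<chi>. dirichlet_character N \<chi>}"
  consider "[a = 1] (mod N)" | "\<not> coprime a N" "\<not> [a = 1] (mod N)" | "coprime a N" "\<not> [a = 1] (mod N)"
    by blast
  thus ?thesis
  proof cases
    case 1
    hence "(\<Sum>\<chi>\<in>?X. \<chi> a) = (\<Sum>\<chi>\<in>?X. 1)"
      using dirichlet_character_cong dirichlet_character_1 by (intro sum.cong refl) (metis mem_Collect_eq)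
    thus ?thesis
      using 1 by simp
  next
    case 2
    thus ?thesis
      by (auto intro!: sum.neutral simp: dirichlet_character_eq_0_iff)
  next
    case 3
    obtain \<psi> where \<psi>: "dirichlet_character N \<psi>" "\<psi> a \<noteq> 1"
      using exists_dirichlet_character_neq_1[OF assms 3] .
    define T where "T = (\<lambda>\<chi> b. \<psi> b * \<chi> b)"
    have "inj_on T ?X"
    proof (rule inj_onI, rule ext)
      fix \<chi>1 \<chi>2 b
      assume *: "\<chi>1 \<in> ?X" "\<chi>2 \<in> ?X" "T \<chi>1 = T \<chi>2"
      show "\<chi>1 b = \<chi>2 b"
        using fun_cong[OF *(3), of b] dirichlet_character_eq_0_iff[OF \<psi>(1), of b]
          dirichlet_character_eq_0_iff[of N \<chi>1 b] dirichlet_character_eq_0_iff[of N \<chi>2 b] *(1,2)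
        by (auto simp: T_def)
    qed
    moreover have "T ` ?X \<subseteq> ?X"
      using dirichlet_character_times[OF \<psi>(1)] by (auto simp: T_def)
    ultimately have "bij_betw T ?X ?X"
      using endo_inj_surj[OF finite_dirichlet_characters[OF assms]] by (auto simp: bij_betw_def)
    hence "(\<Sum>\<chi>\<in>?X. \<chi> a) = (\<Sum>\<chi>\<in>?X. T \<chi> a)"
      by (intro sum.reindex_bij_betw[symmetric])
    also have "\<dots> = \<psi> a * (\<Sum>\<chi>\<in>?X. \<chi> a)"
      by (simp add: T_def sum_distrib_left)
    finally have "(\<Sum>\<chi>\<in>?X. \<chi> a) = 0"
      using \<psi>(2) by simp
    thus ?thesis
      using 3 by simp
  qed
qed

text \<open>Multiplication by a unit \<open>a\<close> with \<open>\<chi> a \<noteq> 1\<close>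
  permutes the residues and multiplies the sum by \<open>\<chi> a\<close>.\<close>

lemma sum_nonprincipal_dirichlet_character:
  assumes "N > 0" and chi: "dirichlet_character N \<chi>" and nt: "\<chi> \<noteq> (\<lambda>a. of_bool (coprime a N))"
  shows "(\<Sum>i<N. \<chi> i) = 0"
proof -
  obtain a where a: "coprime a N" "\<chi> a \<noteq> 1"
    using nt dirichlet_character_eq_0_iff[OF chi] by (metis (full_types) of_bool_eq(1,2))
  define h where "h = (\<lambda>i. a * i mod N)"
  have "inj_on h {..<N}"
  proof (rule inj_onI)
    fix x y assume "x \<in> {..<N}" "y \<in> {..<N}" "h x = h y"
    hence "[x = y] (mod N)"
      using a by (simp add: h_def flip: cong_def) (simp add: cong_mult_lcancel_nat)
    thus "x = y"
      using \<open>x \<in> _\<close> \<open>y \<in> _\<close> by (simp add: cong_def)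
  qed
  moreover have "h ` {..<N} \<subseteq> {..<N}"
    using assms by (auto simp: h_def)
  ultimately have "bij_betw h {..<N} {..<N}"
    using endo_inj_surj[of "{..<N}" h] by (auto simp: bij_betw_def)
  hence "(\<Sum>i<N. \<chi> i) = (\<Sum>i<N. \<chi> (h i))"
    by (intro sum.reindex_bij_betw[symmetric])
  also have "\<dots> = \<chi> a * (\<Sum>i<N. \<chi> i)"
    by (simp add: h_def dirichlet_character_mod[OF chi] dirichlet_character_mult[OF chi] sum_distrib_left)
  finally show ?thesis
    using a by simp
qed

text \<open>Full periods cancel, so an initial segment contributes at most \<open>N\<close>; the
  factor \<open>2\<close> comes from writing an interval as a difference of two initial
  segments.\<close>

lemma norm_sum_dirichlet_character_le:
  assumes "N > 0" and chi: "dirichlet_character N \<chi>" and nt: "\<chi> \<noteq> (\<lambda>a. of_bool (coprime a N))"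
  shows "norm (\<Sum>i=m..<n. \<chi> i) \<le> 2 * N"
proof -
  have le: "norm (\<Sum>i<n. \<chi> i) \<le> N" for n
  proof -
    have full: "(\<Sum>i<q * N. \<chi> i) = 0" for q
    proof (induction q)
      case (Suc q)
      have "(\<Sum>i<Suc q * N. \<chi> i) = (\<Sum>i<q * N. \<chi> i) + (\<Sum>i<N. \<chi> (i + q * N))"
        using sum.nat_group[of \<chi> N "Suc q"] sum.nat_group[of \<chi> N q]
        by (simp add: sum.shift_bounds_nat_ivl atLeast0LessThan[symmetric] add_ac
              sum.shift_bounds_nat_ivl[of _ 0 "q * N" N, simplified])
      also have "(\<Sum>i<N. \<chi> (i + q * N)) = (\<Sum>i<N. \<chi> i)"
        by (intro sum.cong dirichlet_character_cong[OF chi]) (auto simp: cong_def)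
      finally show ?case
        using Suc sum_nonprincipal_dirichlet_character[OF assms] by simp
    qed simp
    define q where "q = n div N"
    have "{..<n} = {..<q * N} \<union> {q * N..<n}"
      by (auto simp: q_def)
        (metis div_times_less_eq_dividend le_less_trans less_le_trans nat_less_le)
    hence "(\<Sum>i<n. \<chi> i) = (\<Sum>i<q * N. \<chi> i) + (\<Sum>i=q * N..<n. \<chi> i)"
      by (simp add: sum.union_disjoint ivl_disj_int)
    hence "norm (\<Sum>i<n. \<chi> i) = norm (\<Sum>i=q * N..<n. \<chi> i)"
      by (simp add: full)
    also have "\<dots> \<le> (\<Sum>i=q * N..<n. 1)"
      by (intro sum_norm_le norm_dirichlet_character_le[OF chi] assms)
    also have "\<dots> = real (n mod N)"
      by (simp add: q_def modulo_nat_def)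
    also have "\<dots> \<le> N"
      using assms by (simp add: less_imp_le)
    finally show ?thesis .
  qed
  show ?thesis
  proof (cases "m \<le> n")
    case True
    hence "(\<Sum>i=m..<n. \<chi> i) = (\<Sum>i<n. \<chi> i) - (\<Sum>i<m. \<chi> i)"
      using sum_diff_nat_ivl[of 0 m n \<chi>] by (simp add: atLeast0LessThan)
    hence "norm (\<Sum>i=m..<n. \<chi> i) \<le> norm (\<Sum>i<n. \<chi> i) + norm (\<Sum>i<m. \<chi> i)"
      by (simp add: norm_triangle_ineq4)
    thus ?thesis
      using le[of m] le[of n] by simp
  qed auto
qed

section \<open>Summation lemmas\<close>

text \<open>Summation by parts: the weights \<open>g i - g (Suc i)\<close> and \<open>g n\<close>
  are nonnegative and add up to \<open>g m\<close>.\<close>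

lemma norm_sum_antimono_le:
  fixes f :: "nat \<Rightarrow> 'a :: real_normed_vector" and g :: "nat \<Rightarrow> real"
  assumes f: "\<And>n. norm (\<Sum>i=m..<n. f i) \<le> B"
    and nonneg: "\<And>n. n \<ge> m \<Longrightarrow> g n \<ge> 0" and dec: "\<And>n. n \<ge> m \<Longrightarrow> g (Suc n) \<le> g n"
  shows "norm (\<Sum>i=m..<n. g i *\<^sub>R f i) \<le> B * g m"
proof (cases "m \<le> n")
  case True
  have B: "B \<ge> 0"
    using f[of m] by simp
  have eq: "(\<Sum>i=m..<n. g i *\<^sub>R f i) =
      (\<Sum>i=m..<n. (g i - g (Suc i)) *\<^sub>R (\<Sum>j=m..<Suc i. f j)) + g n *\<^sub>R (\<Sum>i=m..<n. f i)"
    using True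
    by (induction n rule: dec_induct) (auto simp: algebra_simps)
  have tel: "(\<Sum>i=m..<n. g i - g (Suc i)) = g m - g n"
    using True by (rule sum_Suc_diff'[of m n "\<lambda>i. - g i", simplified])
  have "norm (\<Sum>i=m..<n. g i *\<^sub>R f i) \<le>
      (\<Sum>i=m..<n. (g i - g (Suc i)) * B) + g n * B"
    unfolding eq
  proof (intro norm_triangle_mono sum_norm_le)
    fix i assume "i \<in> {m..<n}"
    thus "norm ((g i - g (Suc i)) *\<^sub>R (\<Sum>j=m..<Suc i. f j)) \<le> (g i - g (Suc i)) * B"
      using dec[of i] f[of "Suc i"] unfolding norm_scaleR
      by (intro mult_mono) auto
  next
    show "norm (g n *\<^sub>R (\<Sum>i=m..<n. f i)) \<le> g n * B"
      using nonneg[of n] f[of n] True B by (auto intro!: mult_mono)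
  qed
  also have "\<dots> = B * g m"
    by (simp add: tel flip: sum_distrib_right) (simp add: algebra_simps)
  finally show ?thesis .
qed (use f[of m] nonneg[of m] in auto)

lemma norm_suminf_le_of_partial_sums:
  fixes f :: "nat \<Rightarrow> 'a :: real_normed_vector"
  assumes "f sums S" "\<And>n. norm (\<Sum>i<n. f i) \<le> B"
  shows "norm S \<le> B"
  using assms by (auto simp: sums_def intro!: LIMSEQ_le_const2[OF tendsto_norm])

text \<open>Dirichlet's test. Monotonicity is asked only from \<open>k\<close> on, because weights
  such as \<open>real n powr -s\<close> have the value \<open>0\<close> at
  \<open>n = 0\<close>.\<close>

lemma summable_antimono_mult:
  fixes f :: "nat \<Rightarrow> 'a :: banach" and g :: "nat \<Rightarrow> real"
  assumes f: "\<And>m n. norm (\<Sum>i=m..<n. f i) \<le> B"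
    and nonneg: "\<And>n. n \<ge> k \<Longrightarrow> g n \<ge> 0" and dec: "\<And>n. n \<ge> k \<Longrightarrow> g (Suc n) \<le> g n"
    and lim: "g \<longlonglongrightarrow> 0"
  shows "summable (\<lambda>n. g n *\<^sub>R f n)"
  unfolding summable_Cauchy
proof (intro allI impI)
  fix e :: real assume e: "e > 0"
  have B: "B \<ge> 0"
    using f[of 0 0] by simp
  have "(\<lambda>n. B * g n) \<longlonglongrightarrow> 0"
    using tendsto_mult_right_zero[OF lim] .
  hence "eventually (\<lambda>n. B * g n < e) sequentially"
    using e by (rule order_tendstoD(2))
  then obtain M where M: "\<And>n. n \<ge> M \<Longrightarrow> B * g n < e"
    by (auto simp: eventually_sequentially)
  show "\<exists>M. \<forall>m\<ge>M. \<forall>n. norm (\<Sum>i=m..<n. g i *\<^sub>R f i) < e"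
  proof (intro exI allI impI)
    fix m n assume "max M k \<le> m"
    hence "norm (\<Sum>i=m..<n. g i *\<^sub>R f i) \<le> B * g m"
      by (intro norm_sum_antimono_le f nonneg dec) auto
    also have "\<dots> < e"
      using M[of m] \<open>max M k \<le> m\<close> by simp
    finally show "norm (\<Sum>i=m..<n. g i *\<^sub>R f i) < e" .
  qed
qed

lemma has_sum_pos_imp_sums:
  fixes f :: "nat \<Rightarrow> 'a :: {topological_comm_monoid_add, t2_space}"
  assumes "(f has_sum S) {0<..}" "f 0 = 0"
  shows "f sums S"
proof (rule has_sum_imp_sums)
  show "(f has_sum S) UNIV"
    by (rule has_sum_cong_neutral[THEN iffD1, OF _ _ _ assms(1)]) (use assms(2) in auto)
qed

text \<open>At \<open>n = 0\<close> the set of divisors is infinite, so the inner sum has the junk value \<open>0\<close>.\<close>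

lemma sums_sum_divisors:
  fixes g :: "nat \<Rightarrow> nat \<Rightarrow> 'a :: banach"
  assumes "((\<lambda>(d, e). g d e) has_sum S) ({0<..} \<times> {0<..})"
  shows "(\<lambda>n. \<Sum>d | d dvd n. g d (n div d)) sums S"
proof (rule has_sum_pos_imp_sums)
  have "((\<lambda>(n, d). g d (n div d)) has_sum S) (SIGMA n:{0<..}. {d. d dvd n}) \<longleftrightarrow>
      ((\<lambda>(d, e). g d e) has_sum S) ({0<..} \<times> {0<..})"
    by (rule has_sum_reindex_bij_witness[of _ "\<lambda>(d, e). (d * e, d)" "\<lambda>(n, d). (d, n div d)"])
       (auto elim!: dvdE)
  with assms have "((\<lambda>(n, d). g d (n div d)) has_sum S) (SIGMA n:{0<..}. {d. d dvd n})"
    by simp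
  thus "((\<lambda>n. \<Sum>d | d dvd n. g d (n div d)) has_sum S) {0<..}"
    by (rule has_sum_SigmaD) (auto intro!: has_sum_finite)
qed auto

lemma
  fixes f :: "'a \<Rightarrow> 'c :: {real_normed_field, banach}"
  assumes f: "(\<lambda>x. norm (f x)) summable_on A" and g: "(\<lambda>y. norm (g y)) summable_on B"
  shows abs_summable_on_Times: "(\<lambda>(x, y). norm (f x * g y)) summable_on A \<times> B"
    and has_sum_Times: "((\<lambda>(x, y). f x * g y) has_sum (infsum f A * infsum g B)) (A \<times> B)"
proof -
  have "((\<lambda>y. case (x, y) of (x, y) \<Rightarrow> norm (f x * g y)) has_sum norm (f x) * infsum (\<lambda>y. norm (g y)) B) B" for x
    using has_sum_cmult_right[OF has_sum_infsum[OF g], of "norm (f x)"] by (simp add: norm_mult)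
  thus *: "(\<lambda>(x, y). norm (f x * g y)) summable_on A \<times> B"
    using summable_on_cmult_left[OF f] by (rule summable_on_SigmaI) simp
  show "((\<lambda>(x, y). f x * g y) has_sum (infsum f A * infsum g B)) (A \<times> B)"
  proof (rule has_sum_SigmaI)
    show "((\<lambda>y. case (x, y) of (x, y) \<Rightarrow> f x * g y) has_sum (f x * infsum g B)) B" for x
      using has_sum_cmult_right[OF has_sum_infsum[OF abs_summable_summable[OF g]], of "f x"] by simp
    show "((\<lambda>x. f x * infsum g B) has_sum (infsum f A * infsum g B)) A"
      by (rule has_sum_cmult_left[OF has_sum_infsum[OF abs_summable_summable[OF f]]])
    show "(\<lambda>(x, y). f x * g y) summable_on A \<times> B"
      by (rule abs_summable_summable) (use * in \<open>simp add: case_prod_unfold\<close>)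
  qed
qed

section \<open>Real characters\<close>

text \<open>A divisor of \<open>a * b\<close> is a product of a divisor of \<open>a\<close> and one
  of \<open>b\<close>, which are recovered as its gcds with \<open>a\<close> and
  \<open>b\<close>.\<close>

lemma sum_divisors_mult_coprime:
  fixes c :: "nat \<Rightarrow> 'a :: comm_semiring_1"
  assumes mult: "\<And>a b. c (a * b) = c a * c b" and "coprime a b" "a > 0" "b > 0"
  shows "(\<Sum>d | d dvd a * b. c d) = (\<Sum>d | d dvd a. c d) * (\<Sum>d | d dvd b. c d)"
proof -
  have gcd: "gcd (x * y) a = x" "gcd (x * y) b = y" if "x dvd a" "y dvd b" for x y
  proof -
    have "coprime a y" "coprime x b"
      using coprime_divisors[OF dvd_refl that(2) \<open>coprime a b\<close>]
        coprime_divisors[OF that(1) dvd_refl \<open>coprime a b\<close>] by this+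
    hence "coprime a y" "coprime b x"
      by (simp_all only: coprime_commute[of b x])
    hence "gcd (x * y) a = gcd x a" "gcd (x * y) b = gcd y b"
      by (simp_all only: gcd_mult_left_right_cancel gcd_mult_left_left_cancel)
    with that show "gcd (x * y) a = x" "gcd (x * y) b = y"
      by (simp_all only: gcd_nat.absorb1)
  qed
  have "(\<Sum>d | d dvd a * b. c d) = (\<Sum>(x, y)\<in>{d. d dvd a} \<times> {d. d dvd b}. c (x * y))"
  proof (rule sum.reindex_bij_witness[of _ "\<lambda>(x, y). x * y" "\<lambda>d. (gcd d a, gcd d b)"])
    fix d assume "d \<in> {d. d dvd a * b}"
    then obtain x y where "d = x * y" "x dvd a" "y dvd b"
      using division_decomp by blast
    thus "(case (gcd d a, gcd d b) of (x, y) \<Rightarrow> x * y) = d"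
      "(case (gcd d a, gcd d b) of (x, y) \<Rightarrow> c (x * y)) = c d"
      by (simp_all add: gcd)
  next
    fix z assume "z \<in> {d. d dvd a} \<times> {d. d dvd b}"
    then obtain x y where "z = (x, y)" "x dvd a" "y dvd b"
      by blast
    thus "(gcd (case z of (x, y) \<Rightarrow> x * y) a, gcd (case z of (x, y) \<Rightarrow> x * y) b) = z"
      "(case z of (x, y) \<Rightarrow> x * y) \<in> {d. d dvd a * b}"
      by (simp_all add: gcd mult_dvd_mono)
  qed auto
  also have "\<dots> = (\<Sum>d | d dvd a. c d) * (\<Sum>d | d dvd b. c d)"
    by (simp add: mult sum_product sum.cartesian_product)
  finally show ?thesis .
qed

text \<open>The sum is \<open>1\<close> at \<open>x = 0\<close>, \<open>k + 1\<close> at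
  \<open>x = 1\<close>, and alternates between \<open>1\<close> and \<open>0\<close> at
  \<open>x = -1\<close>.\<close>

lemma sum_powers_sign_ge:
  fixes x :: real
  assumes "x \<in> {-1, 0, 1}"
  shows "(\<Sum>i\<le>k. x ^ i) \<ge> of_bool (even k)"
proof -
  have "(\<Sum>i\<le>k. (-1 :: real) ^ i) = of_bool (even k)"
    by (induction k) auto
  moreover have "(\<Sum>i\<le>k. (0 :: real) ^ i) = 1"
    by (induction k) auto
  ultimately show ?thesis
    using assms by auto
qed

lemma sum_divisors_prime_power_ge:
  fixes c :: "nat \<Rightarrow> real"
  assumes mult: "\<And>a b. c (a * b) = c a * c b" and "c 1 = 1" and "\<And>a. c a \<in> {-1, 0, 1}" and "prime p"
  shows "(\<Sum>d | d dvd p ^ k. c d) \<ge> of_bool (even k)"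
proof -
  have pow: "c (p ^ i) = c p ^ i" for i
    using mult \<open>c 1 = 1\<close> by (induction i) simp_all
  have "(\<Sum>d | d dvd p ^ k. c d) = (\<Sum>d\<in>(^) p ` {..k}. c d)"
    using divides_primepow_nat[OF \<open>prime p\<close>] by (intro sum.cong) auto
  also have "\<dots> = (\<Sum>i\<le>k. c p ^ i)"
    using prime_gt_1_nat[OF \<open>prime p\<close>] by (subst sum.reindex) (auto simp: inj_on_def pow)
  finally show ?thesis
    using sum_powers_sign_ge[OF assms(3)] by simp
qed

text \<open>The divisor sum is multiplicative and nonnegative at prime powers; the induction splits
  off the full power of one prime.\<close>

lemma sum_divisors_nonneg:
  fixes c :: "nat \<Rightarrow> real"
  assumes mult: "\<And>a b. c (a * b) = c a * c b" and "c 1 = 1" and "\<And>a. c a \<in> {-1, 0, 1}" and "m > 0"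
  shows "(\<Sum>d | d dvd m. c d) \<ge> 0"
  using \<open>m > 0\<close>
proof (induction m rule: less_induct)
  case (less m)
  show ?case
  proof (cases "m = 1")
    case False
    then obtain p where p: "prime p" "p dvd m"
      by (metis prime_factor_nat)
    obtain b where b: "m = p ^ multiplicity p m * b" "\<not> p dvd b"
      using less.prems p by (metis multiplicity_decompose' neq0_conv not_prime_unit)
    define k where "k = multiplicity p m"
    have "b > 0"
      using less.prems b by (auto intro!: Nat.gr0I)
    have "k > 0"
      using p less.prems by (simp add: k_def prime_multiplicity_gt_zero_iff)
    hence "p ^ k > 1"
      using prime_gt_1_nat[OF p(1)] by (intro one_less_power)
    hence "b < m"
      using b(1) \<open>b > 0\<close> by (metis k_def mult_less_cancel2 nat_mult_1)
    have "coprime (p ^ k) b"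
      using p b by (simp add: prime_imp_coprime)
    hence "(\<Sum>d | d dvd m. c d) = (\<Sum>d | d dvd p ^ k. c d) * (\<Sum>d | d dvd b. c d)"
      using sum_divisors_mult_coprime[of c "p ^ k" b] mult b(1) \<open>b > 0\<close> prime_gt_0_nat[OF p(1)]
      by (simp add: k_def)
    moreover have "(\<Sum>d | d dvd p ^ k. c d) \<ge> 0"
      by (rule order_trans[OF _ sum_divisors_prime_power_ge[OF assms(1-3) p(1)]]) auto
    ultimately show ?thesis
      using less.IH[OF \<open>b < m\<close> \<open>b > 0\<close>] by simp
  qed (use \<open>c 1 = 1\<close> in simp)
qed

text \<open>The inequality of arithmetic and geometric means for opposite terms of the sum, whose
  square roots multiply to \<open>u ^ (n - 1)\<close>. Working with \<open>u\<close> instead of its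
  square avoids half-integral exponents.\<close>

lemma mult_power_le_sum_powers:
  fixes u :: real
  assumes "u \<ge> 0"
  shows "real n * u ^ (n - 1) \<le> (\<Sum>i<n. (u\<^sup>2) ^ i)"
proof -
  have "2 * (\<Sum>i<n. (u\<^sup>2) ^ i) = (\<Sum>i<n. (u ^ i)\<^sup>2) + (\<Sum>i<n. (u ^ (n - Suc i))\<^sup>2)"
    using sum.nat_diff_reindex[of "\<lambda>i. (u ^ i)\<^sup>2" n] by (simp add: power_mult[symmetric] mult.commute)
  also have "\<dots> = (\<Sum>i<n. (u ^ i)\<^sup>2 + (u ^ (n - Suc i))\<^sup>2)"
    by (simp add: sum.distrib)
  also have "\<dots> \<ge> (\<Sum>i<n. 2 * u ^ (n - 1))"
  proof (rule sum_mono)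
    fix i assume "i \<in> {..<n}"
    hence "u ^ (n - 1) = u ^ i * u ^ (n - Suc i)"
      by (simp flip: power_add)
    thus "2 * u ^ (n - 1) \<le> (u ^ i)\<^sup>2 + (u ^ (n - Suc i))\<^sup>2"
      using sum_squares_bound[of "u ^ i" "u ^ (n - Suc i)"] by simp
  qed
  finally show ?thesis
    by simp
qed

text \<open>With \<open>S n\<close> for the geometric sum, the two parts drop by
  \<open>1 / (n * (n + 1))\<close> and \<open>t ^ n / (S n * S (n + 1))\<close>. Applying
  \<open>mult_power_le_sum_powers\<close> to both factors shows that the first drop is at least the
  second.\<close>

lemma monsky_decreasing:
  fixes t :: real
  assumes t: "t > 0" "t < 1" and n: "n > 0"
  defines "b \<equiv> \<lambda>n. 1 / real n - t ^ n / (\<Sum>i<n. t ^ i)"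
  shows "b (Suc n) \<le> b n"
proof -
  have *: "x * z \<le> y \<Longrightarrow> y > 0 \<Longrightarrow> x > 0 \<Longrightarrow> z / y \<le> 1 / x" for x y z :: real
    by (simp add: field_simps)
  define u where "u = sqrt t"
  have u: "u > 0" "u < 1" "t = u\<^sup>2"
    using t by (auto simp: u_def)
  define S where "S = (\<lambda>n. \<Sum>i<n. t ^ i)"
  have S: "S n > 0" if "n > 0" for n
    unfolding S_def using that t by (intro sum_pos) auto
  have "(\<Sum>i<Suc n. t ^ i) = 1 + t * (\<Sum>i<n. t ^ i)"
    by (subst sum.lessThan_Suc_shift) (simp add: sum_distrib_left)
  hence rec: "S (Suc n) = 1 + t * S n"
    by (simp add: S_def)
  have "real n * real (Suc n) * t ^ n \<le> real n * real (Suc n) * u ^ (2 * n - 1)"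
    using u n by (intro mult_left_mono) (auto simp flip: power_mult intro!: power_decreasing)
  also have "u ^ (2 * n - 1) = u ^ (n - 1) * u ^ (Suc n - 1)"
    using n by (simp flip: power_add add: mult_2)
  also have "real n * real (Suc n) * (u ^ (n - 1) * u ^ (Suc n - 1)) =
      (real n * u ^ (n - 1)) * (real (Suc n) * u ^ (Suc n - 1))"
    by simp
  also have "\<dots> \<le> S n * S (Suc n)"
    unfolding S_def u(3) using u
    by (intro mult_mono mult_power_le_sum_powers sum_nonneg) auto
  finally have "real n * real (Suc n) * t ^ n \<le> S n * S (Suc n)" .
  moreover have "S n * S (Suc n) > 0" "real n * real (Suc n) > 0"
    using S[of n] S[of "Suc n"] n by simp_all
  ultimately have "t ^ n / (S n * S (Suc n)) \<le> 1 / (real n * real (Suc n))"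
    using * by blast
  also have "t ^ n / (S n * S (Suc n)) = t ^ n / S n - t ^ Suc n / S (Suc n)"
    using S[of n] S[of "Suc n"] n rec by (simp add: divide_simps) (simp add: algebra_simps)
  also have "1 / (real n * real (Suc n)) = 1 / real n - 1 / real (Suc n)"
    using n by (simp add: field_simps)
  finally show ?thesis
    by (simp add: b_def S_def del: sum.lessThan_Suc)
qed

lemma real_character_sum_nonzero:
  fixes c :: "nat \<Rightarrow> real"
  assumes mult: "\<And>a b. c (a * b) = c a * c b" and c1: "c 1 = 1" and sgn: "\<And>a. c a \<in> {-1, 0, 1}"
    and bounded: "\<And>m n. \<bar>\<Sum>i=m..<n. c i\<bar> \<le> B"
    and sums: "(\<lambda>n. c n / real n) sums S"
  shows "S \<noteq> 0"
proof
  assume "S = 0"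
  define r where "r = (\<lambda>n. \<Sum>d | d dvd n. c d)"
  have r_nonneg: "r n \<ge> 0" for n
    using sum_divisors_nonneg[OF mult c1 sgn, of n] by (cases "n = 0") (auto simp: r_def)
  \<comment> \<open>\<open>4 ^ j = 2 ^ (2 * j)\<close> is a prime power with even exponent.\<close>
  have r_4: "r (4 ^ j) \<ge> 1" for j
    using sum_divisors_prime_power_ge[OF mult c1 sgn two_is_prime_nat, of "2 * j"]
    by (simp add: r_def power_mult)
  have abs_c: "\<bar>c a\<bar> \<le> 1" for a
    using sgn[of a] by auto
  \<comment> \<open>A bound uniform in \<open>t\<close> and \<open>J\<close>: the Lambert series
    \<open>T\<close> dominates the left side, and \<open>S = 0\<close> yields
    \<open>\<bar>T\<bar> \<le> B\<close>. As \<open>t\<close> tends to \<open>1\<close> the left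
    side tends to \<open>J\<close>, which can be taken larger than \<open>B\<close>.\<close>
  have le: "(\<Sum>j<J. t ^ (4 ^ j)) \<le> B" if t: "t > 0" "t < 1" for t :: real and J :: nat
  proof -
    define T where "T = (\<Sum>\<^sub>\<infinity>(d, e)\<in>{0<..} \<times> {0<..}. c d * t ^ (d * e))"
    define P :: "(nat \<times> nat) set" where "P = {0<..} \<times> {0<..}"
    have "summable (\<lambda>n. t ^ n)"
      using t by (intro summable_geometric) auto
    hence geo: "(\<lambda>n. t ^ n) summable_on UNIV"
      using t by (intro summable_nonneg_imp_summable_on) auto
    hence geo': "(\<lambda>n. t ^ n) summable_on {0<..}"
      by (rule summable_on_subset) auto
    \<comment> \<open>The double series is dominated by \<open>t ^ (d + e - 1)\<close>, since
      \<open>d + e - 1 \<le> d * e\<close> for positive \<open>d\<close> and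
      \<open>e\<close>.\<close>
    have "(\<lambda>(d, e). t ^ d * t ^ e) summable_on P"
      using abs_summable_on_Times[of "\<lambda>n. t ^ n" "{0<..}" "\<lambda>n. t ^ n" "{0<..}"] geo' t
      by (simp add: P_def)
    hence "(\<lambda>x. 1 / t * (case x of (d, e) \<Rightarrow> t ^ d * t ^ e)) summable_on P"
      by (rule summable_on_cmult_right)
    hence dom: "(\<lambda>(d, e). 1 / t * (t ^ d * t ^ e)) summable_on P"
      by (simp add: case_prod_unfold)
    have "(\<lambda>(d, e). c d * t ^ (d * e)) summable_on P"
    proof (rule abs_summable_summable, rule Infinite_Sum.abs_summable_on_comparison_test'[OF dom])
      fix x assume "x \<in> P"
      then obtain d e where x: "x = (d, e)" "d > 0" "e > 0"
        by (auto simp: P_def)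
      have "d + e - 1 \<le> d * e"
        using x by (cases d; cases e) auto
      hence "t ^ (d * e) \<le> t ^ (d + e - 1)"
        using t by (intro power_decreasing) auto
      also have "\<dots> = 1 / t * (t ^ d * t ^ e)"
        using x t by (cases d) (auto simp: power_add)
      finally have "t ^ (d * e) \<le> 1 / t * (t ^ d * t ^ e)" .
      moreover have "\<bar>c d * t ^ (d * e)\<bar> \<le> 1 * t ^ (d * e)"
        unfolding abs_mult using abs_c t by (intro mult_mono) auto
      ultimately show "norm (case x of (d, e) \<Rightarrow> c d * t ^ (d * e)) \<le>
          (case x of (d, e) \<Rightarrow> 1 / t * (t ^ d * t ^ e))"
        by (simp add: x)
    qed
    hence T: "((\<lambda>(d, e). c d * t ^ (d * e)) has_sum T) ({0<..} \<times> {0<..})"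
      unfolding T_def P_def by (rule has_sum_infsum)
    \<comment> \<open>Grouping the pairs by the product \<open>d * e\<close> gives the power series
      of \<open>r\<close>; grouping them by \<open>d\<close>, further below, gives the Lambert
      series of \<open>c\<close>.\<close>
    have "(\<lambda>n. \<Sum>d | d dvd n. c d * t ^ (d * (n div d))) sums T"
      using T by (rule sums_sum_divisors)
    also have "(\<lambda>n. \<Sum>d | d dvd n. c d * t ^ (d * (n div d))) = (\<lambda>n. r n * t ^ n)"
      by (auto simp: r_def sum_distrib_right)
    finally have rT: "(\<lambda>n. r n * t ^ n) sums T" .
    have "((\<lambda>d. c d * (t ^ d / (1 - t ^ d))) has_sum T) {0<..}"
    proof (rule has_sum_SigmaD[OF T])
      fix d :: nat assume d: "d \<in> {0<..}"
      have "((\<lambda>e. (t ^ d) ^ e) has_sum (t ^ d / (1 - t ^ d))) {1..}"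
        using d t by (intro has_sum_geometric_from_1) (auto simp: power_less_one_iff)
      hence "((\<lambda>e. c d * (t ^ d) ^ e) has_sum (c d * (t ^ d / (1 - t ^ d)))) {1..}"
        by (rule has_sum_cmult_right)
      also have "{1..} = {0::nat<..}"
        by auto
      finally show "((\<lambda>e. case (d, e) of (d, e) \<Rightarrow> c d * t ^ (d * e)) has_sum
          c d * (t ^ d / (1 - t ^ d))) {0<..}"
        by (simp add: power_mult)
    qed
    hence "(\<lambda>d. c d * (t ^ d / (1 - t ^ d))) sums T"
      by (rule has_sum_pos_imp_sums) auto
    hence "(\<lambda>d. c d / real d - (1 - t) * (c d * (t ^ d / (1 - t ^ d)))) sums (0 - (1 - t) * T)"
      using sums \<open>S = 0\<close> by (intro sums_diff sums_mult) auto
    \<comment> \<open>The geometric sum formula turns \<open>(1 - t) / (1 - t ^ d)\<close> into the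
      reciprocal of \<open>\<Sum>i<d. t ^ i\<close>; at \<open>d = 0\<close> both sides are
      \<open>0\<close> through division by zero.\<close>
    moreover have "c d / real d - (1 - t) * (c d * (t ^ d / (1 - t ^ d))) =
        (1 / real d - t ^ d / (\<Sum>i<d. t ^ i)) * c d" for d
      using t by (simp add: sum_gp_strict field_simps)
    ultimately have *: "(\<lambda>d. (1 / real d - t ^ d / (\<Sum>i<d. t ^ i)) * c d) sums (- ((1 - t) * T))"
      by simp
    have "norm (- ((1 - t) * T)) \<le> B * (1 - t)"
    proof (rule norm_suminf_le_of_partial_sums[OF *])
      fix n
      have "real d * t ^ d \<le> (\<Sum>i<d. t ^ i)" for d
        using sum_mono[of "{..<d}" "\<lambda>_. t ^ d" "\<lambda>i. t ^ i"] t by (simp add: power_decreasing)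
      moreover have "(\<Sum>i<d. t ^ i) > 0" if "d > 0" for d :: nat
        using that t by (intro sum_pos) auto
      ultimately have nonneg: "1 / real d - t ^ d / (\<Sum>i<d. t ^ i) \<ge> 0" if "d \<ge> 1" for d
        using that by (simp add: field_simps)
      \<comment> \<open>Partial summation leaves the first weight, \<open>1 - t\<close>, and this
        factor cancels against the one in front of \<open>T\<close>.\<close>
      have "norm (\<Sum>i=1..<n. (1 / real i - t ^ i / (\<Sum>j<i. t ^ j)) *\<^sub>R c i) \<le>
          B * (1 / real 1 - t ^ 1 / (\<Sum>i<1. t ^ i))"
      proof (rule norm_sum_antimono_le[where g = "\<lambda>i. 1 / real i - t ^ i / (\<Sum>j<i. t ^ j)"])
        show "1 / real (Suc i) - t ^ Suc i / (\<Sum>j<Suc i. t ^ j) \<le> 1 / real i - t ^ i / (\<Sum>j<i. t ^ j)"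
          if "1 \<le> i" for i
          using that t by (intro monsky_decreasing) auto
      qed (use bounded nonneg in auto)
      \<comment> \<open>The term at \<open>0\<close> vanishes, both of its quotients being divisions
        by zero.\<close>
      also have "(\<Sum>i=1..<n. (1 / real i - t ^ i / (\<Sum>j<i. t ^ j)) *\<^sub>R c i) =
          (\<Sum>i<n. (1 / real i - t ^ i / (\<Sum>j<i. t ^ j)) *\<^sub>R c i)"
        by (rule sum.mono_neutral_left) (auto simp: Suc_le_eq)
      finally show "norm (\<Sum>i<n. (1 / real i - t ^ i / (\<Sum>j<i. t ^ j)) * c i) \<le> B * (1 - t)"
        by simp
    qed
    hence "\<bar>T\<bar> \<le> B"
      using t by (simp add: abs_mult mult.commute)
    have "(\<Sum>j<J. t ^ (4 ^ j)) \<le> (\<Sum>j<J. r (4 ^ j) * t ^ (4 ^ j))"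
    proof (rule sum_mono)
      fix j
      show "t ^ (4 ^ j) \<le> r (4 ^ j) * t ^ (4 ^ j)"
        using mult_right_mono[OF r_4[of j], of "t ^ (4 ^ j)"] t by simp
    qed
    also have "\<dots> = (\<Sum>n\<in>(^) 4 ` {..<J}. r n * t ^ n)"
      by (subst sum.reindex) (simp_all add: inj_on_def)
    also have "\<dots> \<le> T"
      unfolding sums_unique[OF rT] using t r_nonneg
      by (intro sum_le_suminf sums_summable[OF rT] mult_nonneg_nonneg ballI zero_le_power) auto
    finally show ?thesis
      using \<open>\<bar>T\<bar> \<le> B\<close> by simp
  qed
  obtain J :: nat where "real J > B"
    using reals_Archimedean2 by blast
  have "((\<lambda>t :: real. \<Sum>j<J. t ^ (4 ^ j)) \<longlongrightarrow> (\<Sum>j<J. 1 ^ (4 ^ j))) (at_left 1)"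
    by (intro tendsto_sum tendsto_power tendsto_ident_at)
  hence lim: "((\<lambda>t :: real. \<Sum>j<J. t ^ (4 ^ j)) \<longlongrightarrow> real J) (at_left 1)"
    by (simp only: power_one sum_constant card_lessThan mult_1_right)
  have "eventually (\<lambda>t :: real. t \<in> {0<..<1}) (at_left 1)"
    by (rule eventually_at_left_real) simp
  hence "eventually (\<lambda>t :: real. (\<Sum>j<J. t ^ (4 ^ j)) \<le> B) (at_left 1)"
  proof eventually_elim
    case (elim t)
    thus ?case
      using le[of t J] by simp
  qed
  with lim have "real J \<le> B"
    by (rule tendsto_upperbound) (rule trivial_limit_at_left_real)
  with \<open>real J > B\<close> show False
    by simp
qed

section \<open>L-series on the real axis\<close>

text \<open>The term at \<open>n = 0\<close> vanishes because \<open>0 powr x = 0\<close>. Summation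
  in the natural order gives a meaning to \<open>s = 1\<close>, where convergence for nonprincipal
  characters is not absolute.\<close>

definition dirichlet_series :: "(nat \<Rightarrow> complex) \<Rightarrow> real \<Rightarrow> complex" where
  "dirichlet_series f s = (\<Sum>n. f n * of_real (real n powr -s))"

lemma summable_ln_powr:
  fixes s :: real
  assumes "s > 1"
  shows "summable (\<lambda>n. ln (real n) * real n powr -s)"
proof (rule summable_comparison_test')
  \<comment> \<open>Half of the excess of \<open>s\<close> over \<open>1\<close> absorbs the
    logarithm, the other half keeps the exponent above \<open>1\<close>.\<close>
  define a where "a = (s - 1) / 2"
  have a: "a > 0" "s = 1 + 2 * a"
    using assms by (auto simp: a_def field_simps)
  have "summable (\<lambda>n. real n powr -(1 + a))"
    using a by (simp add: summable_real_powr_iff)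
  thus "summable (\<lambda>n. 1 / a * real n powr -(1 + a))"
    by (rule summable_mult)
  fix n :: nat assume "n \<ge> 1"
  hence "ln (real n) * real n powr -s \<le> real n powr a / a * real n powr -s"
    using a by (intro mult_right_mono ln_powr_bound) auto
  also have "\<dots> = 1 / a * real n powr -(1 + a)"
    using \<open>n \<ge> 1\<close> by (simp add: a(2) powr_add[symmetric]) (simp add: minus_diff_commute)
  finally show "norm (ln (real n) * real n powr -s) \<le> 1 / a * real n powr -(1 + a)"
    using \<open>n \<ge> 1\<close> by simp
qed

text \<open>The bound \<open>1 + ln (real n)\<close> covers a character as well as its products with
  \<open>ln\<close> and \<open>mangoldt\<close>.\<close>

lemma summable_norm_dirichlet_series:
  fixes f :: "nat \<Rightarrow> complex"
  assumes "s > 1" "\<And>n. n > 0 \<Longrightarrow> norm (f n) \<le> 1 + ln (real n)"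
  shows "summable (\<lambda>n. norm (f n * of_real (real n powr -s)))"
proof (rule summable_comparison_test')
  show "summable (\<lambda>n. real n powr -s + ln (real n) * real n powr -s)"
    using assms by (intro summable_add summable_ln_powr) (simp add: summable_real_powr_iff)
  fix n :: nat assume "n \<ge> 1"
  hence "norm (f n) * real n powr -s \<le> (1 + ln (real n)) * real n powr -s"
    using assms by (intro mult_right_mono) auto
  thus "norm (norm (f n * of_real (real n powr -s))) \<le> real n powr -s + ln (real n) * real n powr -s"
    by (simp add: norm_mult algebra_simps)
qed

lemma has_vector_derivative_powr_term:
  fixes z :: complex
  shows "((\<lambda>s. z * of_real (real n powr -s)) has_vector_derivative
    - (z * of_real (ln (real n)) * of_real (real n powr -s))) (at s within S)"
proof (cases "n = 0")
  case False
  have "((\<lambda>s. real n powr -s) has_real_derivative - (ln (real n) * real n powr -s)) (at s within S)"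
    using False unfolding powr_def by (auto intro!: derivative_eq_intros)
  hence "((\<lambda>s. z * of_real (real n powr -s)) has_vector_derivative
      z * of_real (- (ln (real n) * real n powr -s))) (at s within S)"
    by (intro has_vector_derivative_mult_right has_vector_derivative_of_real)
       (simp add: has_real_derivative_iff_has_vector_derivative)
  thus ?thesis
    by (simp add: mult.assoc)
qed auto

lemma has_vector_derivative_dirichlet_series:
  fixes f :: "nat \<Rightarrow> complex"
  assumes "s > 1" and f: "\<And>n. norm (f n) \<le> 1"
  shows "(dirichlet_series f has_vector_derivative
            - dirichlet_series (\<lambda>n. f n * of_real (ln (real n))) s) (at s)"
proof -
  \<comment> \<open>The midpoint of \<open>1\<close> and \<open>s\<close>: the differentiated series
    converges uniformly on \<open>{\<sigma><..}\<close>, an open set that contains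
    \<open>s\<close>.\<close>
  define \<sigma> where "\<sigma> = (1 + s) / 2"
  define g where "g = (\<lambda>n x. f n * of_real (ln (real n)) * of_real (real n powr -x))"
  define G where "G = (\<lambda>x. \<Sum>n. g n x)"
  have \<sigma>: "\<sigma> > 1" "\<sigma> < s"
    using assms by (auto simp: \<sigma>_def)
  have lim: "uniform_limit {\<sigma><..} (\<lambda>n x. \<Sum>i<n. g i x) G sequentially"
    unfolding G_def
  proof (rule Weierstrass_m_test)
    show "summable (\<lambda>n. ln (real n) * real n powr -\<sigma>)"
      using \<sigma> by (intro summable_ln_powr)
    fix n :: nat and x assume x: "x \<in> {\<sigma><..}"
    show "norm (g n x) \<le> ln (real n) * real n powr -\<sigma>"
    proof (cases "n = 0")
      case False
      have "norm (g n x) = norm (f n) * (ln (real n) * real n powr -x)"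
        using False by (simp add: g_def norm_mult)
      also have "\<dots> \<le> 1 * (ln (real n) * real n powr -\<sigma>)"
        using False x f by (intro mult_mono powr_mono) auto
      finally show ?thesis by simp
    qed (simp add: g_def)
  qed
  have "\<exists>h. \<forall>x\<in>{\<sigma><..}. (\<lambda>n. f n * of_real (real n powr -x)) sums (h x) \<and>
      (h has_derivative (\<lambda>y. y *\<^sub>R (- G x))) (at x within {\<sigma><..})"
  proof (rule has_derivative_series)
    show "((\<lambda>x. f n * of_real (real n powr -x)) has_derivative (\<lambda>y. y *\<^sub>R (- g n x)))
        (at x within {\<sigma><..})" for n x
      using has_vector_derivative_powr_term[of "f n" n x "{\<sigma><..}"]
      by (simp add: g_def has_vector_derivative_def)
  next
    fix e :: real assume "e > 0"
    with lim have "\<forall>\<^sub>F n in sequentially. \<forall>x\<in>{\<sigma><..}. dist (\<Sum>i<n. g i x) (G x) < e"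
      by (auto simp: uniform_limit_iff)
    thus "\<forall>\<^sub>F n in sequentially. \<forall>x\<in>{\<sigma><..}. \<forall>h.
        norm ((\<Sum>i<n. h *\<^sub>R (- g i x)) - h *\<^sub>R (- G x)) \<le> e * norm h"
    proof eventually_elim
      case (elim n)
      show ?case
      proof (intro ballI allI)
        fix x h assume "x \<in> {\<sigma><..}"
        with elim have "norm ((\<Sum>i<n. g i x) - G x) \<le> e"
          by (auto simp: dist_norm intro: less_imp_le)
        hence "\<bar>h\<bar> * norm ((\<Sum>i<n. g i x) - G x) \<le> \<bar>h\<bar> * e"
          by (intro mult_left_mono) auto
        moreover have "(\<Sum>i<n. h *\<^sub>R (- g i x)) - h *\<^sub>R (- G x) = - (h *\<^sub>R ((\<Sum>i<n. g i x) - G x))"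
          by (simp add: scaleR_sum_right[symmetric] sum_negf scaleR_diff_right)
        ultimately show "norm ((\<Sum>i<n. h *\<^sub>R (- g i x)) - h *\<^sub>R (- G x)) \<le> e * norm h"
          by (simp add: mult.commute)
      qed
    qed
  next
    have "summable (\<lambda>n. norm (f n * of_real (real n powr -s)))"
      using assms(1)
    proof (rule summable_norm_dirichlet_series)
      show "norm (f n) \<le> 1 + ln (real n)" if "n > 0" for n
        using f[of n] that by (simp add: add_increasing2)
    qed
    thus "(\<lambda>n. f n * of_real (real n powr -s)) sums (\<Sum>n. f n * of_real (real n powr -s))"
      by (rule summable_sums[OF summable_norm_cancel])
  next
    show "s \<in> {\<sigma><..}"
      using \<sigma> by simp
  qed (simp add: convex_real_interval)
  then obtain h where h: "\<And>x. x \<in> {\<sigma><..} \<Longrightarrow> (\<lambda>n. f n * of_real (real n powr -x)) sums (h x)"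
    "\<And>x. x \<in> {\<sigma><..} \<Longrightarrow> (h has_derivative (\<lambda>y. y *\<^sub>R (- G x))) (at x within {\<sigma><..})"
    by blast
  have "(h has_vector_derivative (- G s)) (at s within {\<sigma><..})"
    using h(2)[of s] \<sigma> by (simp add: has_vector_derivative_def)
  hence "(dirichlet_series f has_vector_derivative (- G s)) (at s within {\<sigma><..})"
    by (rule has_vector_derivative_transform[rotated 2])
       (use \<sigma> h(1) in \<open>auto simp: dirichlet_series_def sums_iff\<close>)
  thus ?thesis
    using \<sigma> by (subst (asm) at_within_open) (auto simp: G_def g_def dirichlet_series_def)
qed

section \<open>Absolute convergence and logarithmic derivatives for \<open>s > 1\<close>\<close>

context
  fixes N :: nat and \<chi> :: "nat \<Rightarrow> complex"
  assumes N: "N > 0" and chi: "dirichlet_character N \<chi>"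
begin

lemma summable_norm_L: "s > 1 \<Longrightarrow> summable (\<lambda>n. norm (\<chi> n * of_real (real n powr -s)))"
  by (rule summable_norm_dirichlet_series)
     (use norm_dirichlet_character_le[OF chi N] in \<open>auto simp: add_increasing2\<close>)

lemma summable_norm_deriv_L:
  "s > 1 \<Longrightarrow> summable (\<lambda>n. norm (\<chi> n * of_real (ln (real n)) * of_real (real n powr -s)))"
proof (rule summable_norm_dirichlet_series)
  fix n :: nat assume "n > 0"
  thus "norm (\<chi> n * of_real (ln (real n))) \<le> 1 + ln (real n)"
    using mult_right_mono[OF norm_dirichlet_character_le[OF chi N], of "ln (real n)" n]
    by (simp add: norm_mult)
qed

lemma summable_norm_logderiv_L:
  "s > 1 \<Longrightarrow> summable (\<lambda>n. norm (\<chi> n * mangoldt n * of_real (real n powr -s)))"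
proof (rule summable_norm_dirichlet_series)
  fix n :: nat assume "n > 0"
  have "norm (\<chi> n * mangoldt n) \<le> 1 * mangoldt n"
    unfolding norm_mult norm_mangoldt
    by (intro mult_right_mono norm_dirichlet_character_le[OF chi N] mangoldt_nonneg)
  also have "\<dots> \<le> 1 + ln (real n)"
    using mangoldt_le[OF \<open>n > 0\<close>] by simp
  finally show "norm (\<chi> n * mangoldt n) \<le> 1 + ln (real n)" .
qed

text \<open>Dirichlet convolution: \<open>\<chi>\<close> is completely multiplicative, and
  \<open>mangoldt\<close> summed over the divisors of \<open>n\<close> is \<open>ln n\<close>. The
  product form makes sense at zeros of the L-series too.\<close>

lemma L_times_logderiv:
  assumes s: "s > 1"
  shows "dirichlet_series \<chi> s * dirichlet_series (\<lambda>n. \<chi> n * mangoldt n) s =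
         dirichlet_series (\<lambda>n. \<chi> n * of_real (ln (real n))) s"
proof -
  define f where "f = (\<lambda>n. \<chi> n * mangoldt n * of_real (real n powr -s))"
  define g where "g = (\<lambda>n. \<chi> n * of_real (real n powr -s))"
  have suminf: "infsum h {0<..} = suminf h"
    "(\<lambda>n. norm (h n)) summable_on {0<..}"
    if "summable (\<lambda>n. norm (h n))" "h 0 = 0" for h :: "nat \<Rightarrow> complex"
  proof -
    have "(\<lambda>n. norm (h n)) summable_on UNIV"
      using that by (intro summable_nonneg_imp_summable_on) auto
    thus *: "(\<lambda>n. norm (h n)) summable_on {0<..}"
      by (rule summable_on_subset) auto
    show "infsum h {0<..} = suminf h"
      using has_sum_pos_imp_sums[OF has_sum_infsum[OF abs_summable_summable[OF *]]] that(2)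
      by (simp add: sums_iff)
  qed
  have "((\<lambda>(d, e). f d * g e) has_sum (infsum f {0<..} * infsum g {0<..})) ({0<..} \<times> {0<..})"
    using summable_norm_L summable_norm_logderiv_L s
    by (intro has_sum_Times suminf(2)) (auto simp: f_def g_def)
  hence "(\<lambda>n. \<Sum>d | d dvd n. f d * g (n div d)) sums (infsum f {0<..} * infsum g {0<..})"
    by (rule sums_sum_divisors)
  also have "(\<lambda>n. \<Sum>d | d dvd n. f d * g (n div d)) =
      (\<lambda>n. \<chi> n * of_real (ln (real n)) * of_real (real n powr -s))"
  proof
    fix n :: nat
    show "(\<Sum>d | d dvd n. f d * g (n div d)) = \<chi> n * of_real (ln (real n)) * of_real (real n powr -s)"
    proof (cases "n = 0")
      case False
      have "f d * g (n div d) = \<chi> n * of_real (real n powr -s) * mangoldt d" if "d dvd n" for d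
      proof -
        from that obtain e where e: "n = d * e" ..
        with False show ?thesis
          by (simp add: f_def g_def dirichlet_character_mult[OF chi] powr_mult)
      qed
      hence "(\<Sum>d | d dvd n. f d * g (n div d)) =
          \<chi> n * of_real (real n powr -s) * (\<Sum>d | d dvd n. mangoldt d)"
        by (simp add: sum_distrib_left)
      thus ?thesis
        using mangoldt_sum[OF False, where ?'a = complex] by simp
    qed simp
  qed
  also have "infsum f {0<..} = dirichlet_series (\<lambda>n. \<chi> n * mangoldt n) s"
    unfolding dirichlet_series_def f_def using s
    by (intro suminf(1) summable_norm_logderiv_L) auto
  also have "infsum g {0<..} = dirichlet_series \<chi> s"
    unfolding dirichlet_series_def g_def using s
    by (intro suminf(1) summable_norm_L) auto
  finally show ?thesis
    by (simp add: dirichlet_series_def sums_iff mult.commute)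
qed

lemma has_vector_derivative_L:
  assumes "s > 1"
  shows "(dirichlet_series \<chi> has_vector_derivative
    - (dirichlet_series (\<lambda>n. \<chi> n * mangoldt n) s * dirichlet_series \<chi> s)) (at s)"
  using has_vector_derivative_dirichlet_series[of s \<chi>] assms
    norm_dirichlet_character_le[OF chi N]
  by (simp add: L_times_logderiv[OF assms] mult.commute[of _ "dirichlet_series \<chi> s"])

end

text \<open>The terms from \<open>n = 2\<close> on are compared with the integral of
  \<open>x powr -s\<close>. This limits the growth of the principal series at \<open>1\<close> and
  excludes zeros at \<open>s = 3\<close>.\<close>

lemma norm_L_minus_1_le:
  assumes N: "N > 0" and chi: "dirichlet_character N \<chi>" and s: "s > 1"
  shows "norm (dirichlet_series \<chi> s - 1) \<le> 1 / (s - 1)"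
  unfolding dirichlet_series_def
proof (rule norm_suminf_le_of_partial_sums)
  show "(\<lambda>n. \<chi> n * of_real (real n powr -s) - (if n = 1 then 1 else 0)) sums
      ((\<Sum>n. \<chi> n * of_real (real n powr -s)) - 1)"
    by (intro sums_diff sums_single summable_sums[OF summable_norm_cancel[OF summable_norm_L[OF N chi s]]])
  \<comment> \<open>The mean value theorem for \<open>x powr (1 - s)\<close> makes the integral
    comparison telescope.\<close>
  have step: "real (Suc n) powr -s \<le> (real n powr (1 - s) - real (Suc n) powr (1 - s)) / (s - 1)"
    if n: "n > 0" for n
  proof -
    have "\<exists>z. z > real n \<and> z < real (Suc n) \<and> real (Suc n) powr (1 - s) - real n powr (1 - s) =
        (real (Suc n) - real n) * ((1 - s) * z powr (1 - s - 1))"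
      using n by (intro MVT2) (auto intro!: derivative_eq_intros)
    then obtain z where z: "z > real n" "z < real (Suc n)"
      "real (Suc n) powr (1 - s) - real n powr (1 - s) = (1 - s) * z powr -s"
      by auto
    have "(s - 1) * real (Suc n) powr -s \<le> (s - 1) * z powr -s"
      using s z n by (intro mult_left_mono powr_mono2') auto
    also have "\<dots> = real n powr (1 - s) - real (Suc n) powr (1 - s)"
      using z(3) by (simp add: algebra_simps)
    finally show ?thesis
      using s by (simp add: field_simps)
  qed
  have *: "(\<Sum>i\<le>Suc n. if i = 1 then 0 else real i powr -s) \<le> (1 - real (Suc n) powr (1 - s)) / (s - 1)" for n
  proof (induction n)
    case (Suc n)
    thus ?case
      using step[of "Suc n"] s by (simp add: diff_divide_distrib)
  qed simp
  fix n
  have "norm (\<Sum>i<n. \<chi> i * of_real (real i powr -s) - (if i = 1 then 1 else 0)) \<le>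
      (\<Sum>i<n. if i = 1 then 0 else real i powr -s)"
  proof (intro sum_norm_le)
    fix i
    show "norm (\<chi> i * of_real (real i powr -s) - (if i = 1 then 1 else 0)) \<le>
        (if i = 1 then 0 else real i powr -s)"
      using mult_right_mono[OF norm_dirichlet_character_le[OF chi N], of "real i powr -s" i]
      by (simp add: norm_mult dirichlet_character_Suc_0[OF chi])
  qed
  also have "\<dots> \<le> (\<Sum>i\<le>Suc n. if i = 1 then 0 else real i powr -s)"
    by (intro sum_mono2) auto
  also have "\<dots> \<le> (1 - real (Suc n) powr (1 - s)) / (s - 1)"
    by (rule *)
  also have "\<dots> \<le> 1 / (s - 1)"
    using s by (intro divide_right_mono) auto
  finally show "norm (\<Sum>i<n. \<chi> i * of_real (real i powr -s) - (if i = 1 then 1 else 0)) \<le> 1 / (s - 1)" .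
qed

section \<open>Nonprincipal L-series up to the point \<open>1\<close>\<close>

context
  fixes N :: nat and \<chi> :: "nat \<Rightarrow> complex"
  assumes N: "N > 0" and chi: "dirichlet_character N \<chi>"
    and nonprincipal: "\<chi> \<noteq> (\<lambda>a. of_bool (coprime a N))"
begin

lemma bounded_partial_L:
  assumes "s > 0"
  shows "norm (\<Sum>i<n. \<chi> i * of_real (real i powr -s)) \<le> 2 * N"
proof -
  have "norm (\<Sum>i=1..<n. (real i powr -s) *\<^sub>R \<chi> i) \<le> 2 * N * real 1 powr -s"
    using assms norm_sum_dirichlet_character_le[OF N chi nonprincipal]
    by (intro norm_sum_antimono_le) (auto intro!: powr_mono2')
  also have "(\<Sum>i=1..<n. (real i powr -s) *\<^sub>R \<chi> i) = (\<Sum>i<n. (real i powr -s) *\<^sub>R \<chi> i)"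
    by (rule sum.mono_neutral_left) (auto simp: Suc_le_eq)
  finally show ?thesis
    by (simp add: scaleR_conv_of_real mult.commute)
qed

lemma L_sums:
  assumes "s > 0"
  shows "(\<lambda>n. \<chi> n * of_real (real n powr -s)) sums dirichlet_series \<chi> s"
proof -
  have "summable (\<lambda>n. (real n powr -s) *\<^sub>R \<chi> n)"
  proof (rule summable_antimono_mult[where k = 1])
    show "norm (\<Sum>i=m..<n. \<chi> i) \<le> 2 * N" for m n
      using norm_sum_dirichlet_character_le[OF N chi nonprincipal] .
    show "(\<lambda>n. real n powr -s) \<longlonglongrightarrow> 0"
      using assms by (intro tendsto_neg_powr filterlim_real_sequentially) auto
  qed (use assms in \<open>auto intro!: powr_mono2'\<close>)
  thus ?thesis
    unfolding dirichlet_series_def by (simp add: scaleR_conv_of_real mult.commute sums_iff)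
qed

lemma norm_nonprincipal_L_le: "s > 0 \<Longrightarrow> norm (dirichlet_series \<chi> s) \<le> 2 * N"
  using norm_suminf_le_of_partial_sums[OF L_sums bounded_partial_L] by blast

text \<open>\<open>ln x / x\<close> decreases only from \<open>exp 1\<close> on, so partial
  summation starts at \<open>3\<close>. The terms at \<open>0\<close> and \<open>1\<close> vanish
  and the one at \<open>2\<close> accounts for the extra \<open>1\<close>.\<close>

lemma bounded_partial_deriv_L:
  assumes s: "s \<ge> 1"
  shows "norm (\<Sum>i<n. \<chi> i * of_real (ln (real i)) * of_real (real i powr -s)) \<le> 2 * N + 1"
proof -
  define g where "g = (\<lambda>n. ln (real n) * real n powr -s)"
  have 1: "norm (\<Sum>i=3..<n. g i *\<^sub>R \<chi> i) \<le> 2 * N * g 3"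
  proof (rule norm_sum_antimono_le)
    show "norm (\<Sum>i=3..<n. \<chi> i) \<le> 2 * N" for n
      using norm_sum_dirichlet_character_le[OF N chi nonprincipal] .
    fix n :: nat assume n: "n \<ge> 3"
    show "g n \<ge> 0"
      using n by (simp add: g_def)
    have eq: "g m = ln (real m) / real m * real m powr (1 - s)" if "m > 0" for m
      using that powr_add[of "real m" 1 "-s"] by (simp add: g_def)
    have "ln (real (Suc n)) / real (Suc n) * real (Suc n) powr (1 - s) \<le>
        ln (real n) / real n * real n powr (1 - s)"
      using n s exp_le by (intro mult_mono ln_x_over_x_mono powr_mono2') auto
    thus "g (Suc n) \<le> g n"
      using n by (simp add: eq del: of_nat_Suc)
  qed
  have "ln x * x powr -s \<le> 1" if "x \<ge> 1" for x :: real
  proof -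
    have "ln x * x powr -s \<le> x * x powr -1"
      using that s by (intro mult_mono powr_mono) (auto simp: ln_bound)
    thus ?thesis
      using that by (simp add: powr_minus)
  qed
  hence g: "0 \<le> g i" "g i \<le> 1" if "i > 0" for i
    using that by (auto simp: g_def)
  have "2 * real N * g 3 \<le> 2 * N"
    using g[of 3] by (simp add: mult_left_le)
  moreover have "norm (\<Sum>i<n. g i *\<^sub>R \<chi> i) \<le> norm (\<Sum>i=3..<n. g i *\<^sub>R \<chi> i) + 1"
  proof (cases "n \<ge> 3")
    case True
    have "(\<Sum>i<n. g i *\<^sub>R \<chi> i) = (\<Sum>i<3. g i *\<^sub>R \<chi> i) + (\<Sum>i=3..<n. g i *\<^sub>R \<chi> i)"
      using True sum.atLeastLessThan_concat[of 0 3 n "\<lambda>i. g i *\<^sub>R \<chi> i"]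
      by (simp add: atLeast0LessThan)
    also have "(\<Sum>i<3. g i *\<^sub>R \<chi> i) = g 2 *\<^sub>R \<chi> 2"
      by (simp add: eval_nat_numeral g_def)
    finally have "norm (\<Sum>i<n. g i *\<^sub>R \<chi> i) \<le> norm (g 2 *\<^sub>R \<chi> 2) + norm (\<Sum>i=3..<n. g i *\<^sub>R \<chi> i)"
      by (metis norm_triangle_ineq)
    moreover have "norm (g 2 *\<^sub>R \<chi> 2) \<le> 1"
      using mult_mono[OF g(2)[of 2] norm_dirichlet_character_le[OF chi N, of 2]] g(1)[of 2] by simp
    ultimately show ?thesis by simp
  next
    case False
    hence "n \<in> {0, 1, 2}"
      by auto
    thus ?thesis
      by (auto simp: g_def numeral_2_eq_2)
  qed
  ultimately have "norm (\<Sum>i<n. g i *\<^sub>R \<chi> i) \<le> 2 * N + 1"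
    using 1 by linarith
  thus ?thesis
    by (simp add: g_def scaleR_conv_of_real mult_ac)
qed

lemma norm_deriv_L_le:
  assumes "s > 1"
  shows "norm (dirichlet_series (\<lambda>n. \<chi> n * of_real (ln (real n))) s) \<le> 2 * N + 1"
  unfolding dirichlet_series_def
proof (rule norm_suminf_le_of_partial_sums)
  show "(\<lambda>n. \<chi> n * of_real (ln (real n)) * of_real (real n powr -s)) sums
      (\<Sum>n. \<chi> n * of_real (ln (real n)) * of_real (real n powr -s))"
    by (rule summable_sums[OF summable_norm_cancel[OF summable_norm_deriv_L[OF N chi assms]]])
qed (use bounded_partial_deriv_L[of s] assms in auto)

text \<open>The mean value inequality is applied to partial sums, whose derivatives are bounded
  uniformly on \<open>{1..s}\<close>, before passing to the limit; in this way it reaches the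
  endpoint \<open>1\<close>.\<close>

lemma norm_L_diff_le:
  fixes s :: real
  assumes "s > 1"
  shows "norm (dirichlet_series \<chi> s - dirichlet_series \<chi> 1) \<le> (2 * N + 1) * (s - 1)"
proof (rule norm_suminf_le_of_partial_sums)
  show "(\<lambda>n. \<chi> n * of_real (real n powr -s) - \<chi> n * of_real (real n powr -1)) sums
      (dirichlet_series \<chi> s - dirichlet_series \<chi> 1)"
    using assms by (intro sums_diff L_sums) auto
  fix n
  define P where "P = (\<lambda>s. \<Sum>i<n. \<chi> i * of_real (real i powr -s))"
  have "norm (P s - P 1) \<le> (2 * N + 1) * norm (s - 1)"
  proof (rule differentiable_bound[of "{1..s}"])
    fix x assume x: "x \<in> {1..s}"
    define d where "d = (\<Sum>i<n. - (\<chi> i * of_real (ln (real i)) * of_real (real i powr -x)))"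
    have "(P has_vector_derivative d) (at x within {1..s})"
      unfolding P_def d_def by (intro has_vector_derivative_sum has_vector_derivative_powr_term)
    thus "(P has_derivative (\<lambda>y. y *\<^sub>R (\<Sum>i<n. - (\<chi> i * of_real (ln (real i)) * of_real (real i powr -x)))))
        (at x within {1..s})"
      by (simp add: has_vector_derivative_def d_def)
    have "norm d \<le> 2 * N + 1"
      using bounded_partial_deriv_L[of x n] x by (simp add: d_def sum_negf)
    hence "onorm (\<lambda>y. y *\<^sub>R d) \<le> 2 * N + 1"
      by (intro onorm_bound) (auto simp: mult.commute intro!: mult_left_mono)
    thus "onorm (\<lambda>y. y *\<^sub>R (\<Sum>i<n. - (\<chi> i * of_real (ln (real i)) * of_real (real i powr -x)))) \<le> 2 * N + 1"
      by (simp add: d_def)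
  qed (use assms in auto)
  thus "norm (\<Sum>i<n. \<chi> i * of_real (real i powr -s) - \<chi> i * of_real (real i powr -1)) \<le>
      (2 * N + 1) * (s - 1)"
    using assms by (simp add: P_def sum_subtractf del: of_nat_mult of_nat_add)
qed

end

lemma norm_L_le:
  assumes "N > 0" "dirichlet_character N \<chi>" "s > 1"
  shows "norm (dirichlet_series \<chi> s) \<le> 1 + 1 / (s - 1)"
  using norm_triangle_ineq2[of "dirichlet_series \<chi> s" 1] norm_L_minus_1_le[OF assms] by simp

lemma powr_nat_neg_one: "real n powr -1 = 1 / real n"
  by (cases "n = 0") (simp_all add: powr_neg_one)

section \<open>The Mangoldt series of a residue class and the product of all L-series\<close>

definition mangoldt_residue_series :: "nat \<Rightarrow> nat \<Rightarrow> real \<Rightarrow> real" where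
  "mangoldt_residue_series N b s = (\<Sum>n. of_bool ([n = b] (mod N)) * mangoldt n * real n powr -s)"

lemma summable_mangoldt_residue_series:
  fixes s :: real
  assumes "s > 1"
  shows "summable (\<lambda>n. of_bool (P n) * mangoldt n * real n powr -s)"
proof (rule summable_comparison_test')
  show "summable (\<lambda>n. ln (real n) * real n powr -s)"
    using assms by (rule summable_ln_powr)
  fix n :: nat assume "n \<ge> 1"
  thus "norm (of_bool (P n) * mangoldt n * real n powr -s) \<le> ln (real n) * real n powr -s"
    using mangoldt_le[of n] by (auto simp: abs_mult intro!: mult_right_mono)
qed

lemma mangoldt_residue_series_nonneg: "s > 1 \<Longrightarrow> mangoldt_residue_series N b s \<ge> 0"
  unfolding mangoldt_residue_series_def
  by (intro suminf_nonneg summable_mangoldt_residue_series mult_nonneg_nonneg mangoldt_nonneg) auto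

text \<open>\<open>\<chi> b'\<close> plays the role of the conjugate of \<open>\<chi> b\<close>: as
  \<open>\<chi> b' * \<chi> n = \<chi> (b' * n)\<close>, orthogonality keeps exactly the
  \<open>n\<close> congruent to \<open>b\<close>.\<close>

lemma sum_characters_logderiv:
  assumes N: "N > 0" and s: "s > 1" and b: "[b * b' = 1] (mod N)"
  shows "(\<Sum>\<chi> | dirichlet_character N \<chi>. \<chi> b' * dirichlet_series (\<lambda>n. \<chi> n * mangoldt n) s) =
    of_real (real (card {\<chi>. dirichlet_character N \<chi>}) * mangoldt_residue_series N b s)"
proof -
  let ?X = "{\<chi>. dirichlet_character N \<chi>}"
  have "coprime b' N"
    using b by (metis coprime_mult_left_iff cong_imp_coprime cong_sym coprime_1_left)
  have iff: "[b' * n = 1] (mod N) \<longleftrightarrow> [n = b] (mod N)" for n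
  proof -
    have "[b' * n = 1] (mod N) \<longleftrightarrow> [b' * n = b' * b] (mod N)"
      using b by (metis cong_sym cong_trans mult.commute)
    also have "\<dots> \<longleftrightarrow> [n = b] (mod N)"
      using \<open>coprime b' N\<close> by (rule cong_mult_lcancel_nat)
    finally show ?thesis .
  qed
  have "(\<Sum>\<chi>\<in>?X. \<chi> b' * dirichlet_series (\<lambda>n. \<chi> n * mangoldt n) s) =
      (\<Sum>\<chi>\<in>?X. \<Sum>n. \<chi> b' * (\<chi> n * mangoldt n * of_real (real n powr -s)))"
    unfolding dirichlet_series_def using N s
    by (intro sum.cong refl suminf_mult[symmetric] summable_norm_cancel[OF summable_norm_logderiv_L]) auto
  also have "\<dots> = (\<Sum>n. \<Sum>\<chi>\<in>?X. \<chi> b' * (\<chi> n * mangoldt n * of_real (real n powr -s)))"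
    using N s
    by (intro suminf_sum[symmetric] summable_mult summable_norm_cancel[OF summable_norm_logderiv_L]) auto
  also have "(\<lambda>n. \<Sum>\<chi>\<in>?X. \<chi> b' * (\<chi> n * mangoldt n * of_real (real n powr -s))) =
      (\<lambda>n. of_real (real (card ?X) * (of_bool ([n = b] (mod N)) * mangoldt n * real n powr -s)))"
  proof
    fix n
    have "(\<Sum>\<chi>\<in>?X. \<chi> b' * (\<chi> n * mangoldt n * of_real (real n powr -s))) =
        (\<Sum>\<chi>\<in>?X. \<chi> (b' * n) * (mangoldt n * of_real (real n powr -s)))"
      by (intro sum.cong refl) (simp add: dirichlet_character_mult)
    also have "\<dots> = (\<Sum>\<chi>\<in>?X. \<chi> (b' * n)) * (mangoldt n * of_real (real n powr -s))"
      by (rule sum_distrib_right[symmetric])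
    finally show "(\<Sum>\<chi>\<in>?X. \<chi> b' * (\<chi> n * mangoldt n * of_real (real n powr -s))) =
        of_real (real (card ?X) * (of_bool ([n = b] (mod N)) * mangoldt n * real n powr -s))"
      by (simp only: sum_dirichlet_characters[OF N] iff) simp
  qed
  also have "(\<Sum>n. of_real (real (card ?X) * (of_bool ([n = b] (mod N)) * mangoldt n * real n powr -s))) =
      (of_real (\<Sum>n. real (card ?X) * (of_bool ([n = b] (mod N)) * mangoldt n * real n powr -s)) :: complex)"
    by (intro suminf_of_real[symmetric] summable_mult summable_mangoldt_residue_series s)
  also have "(\<Sum>n. real (card ?X) * (of_bool ([n = b] (mod N)) * mangoldt n * real n powr -s)) =
      real (card ?X) * mangoldt_residue_series N b s"
    unfolding mangoldt_residue_series_def by (intro suminf_mult summable_mangoldt_residue_series s)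
  finally show ?thesis .
qed

text \<open>Logarithmic derivatives add under products; the form without division allows zeros of
  the factors.\<close>

lemma has_vector_derivative_prod_logderiv:
  fixes f :: "'i \<Rightarrow> real \<Rightarrow> complex"
  assumes "finite A" "\<And>i. i \<in> A \<Longrightarrow> (f i has_vector_derivative - (g i * f i x)) (at x)"
  shows "((\<lambda>x. \<Prod>i\<in>A. f i x) has_vector_derivative - ((\<Sum>i\<in>A. g i) * (\<Prod>i\<in>A. f i x))) (at x)"
  using assms
proof (induction rule: finite_induct)
  case (insert i A)
  have "((\<lambda>x. f i x * (\<Prod>i\<in>A. f i x)) has_vector_derivative
      (f i x * - ((\<Sum>i\<in>A. g i) * (\<Prod>i\<in>A. f i x)) + - (g i * f i x) * (\<Prod>i\<in>A. f i x))) (at x)"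
    using insert by (intro has_vector_derivative_mult) auto
  thus ?case
    using insert.hyps by (simp add: algebra_simps)
qed simp

text \<open>Orthogonality at the residue \<open>1\<close> makes the logarithmic derivative of the
  product a nonpositive real \<open>- c x\<close>, so the squared norm has derivative
  \<open>- 2 * c x\<close> times itself.\<close>

lemma norm_prod_L_antimono:
  assumes N: "N > 0" and s: "1 < s" "s \<le> t"
  shows "norm (\<Prod>\<chi> | dirichlet_character N \<chi>. dirichlet_series \<chi> t) \<le>
         norm (\<Prod>\<chi> | dirichlet_character N \<chi>. dirichlet_series \<chi> s)"
proof -
  let ?X = "{\<chi>. dirichlet_character N \<chi>}"
  define P where "P = (\<lambda>s. \<Prod>\<chi>\<in>?X. dirichlet_series \<chi> s)"
  define c where "c = (\<lambda>s. real (card ?X) * mangoldt_residue_series N 1 s)"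
  have deriv: "(P has_vector_derivative - (of_real (c x) * P x)) (at x)" if x: "x > 1" for x
  proof -
    have "(P has_vector_derivative - ((\<Sum>\<chi>\<in>?X. dirichlet_series (\<lambda>n. \<chi> n * mangoldt n) x) * P x)) (at x)"
      unfolding P_def using has_vector_derivative_L[OF N] x
      by (intro has_vector_derivative_prod_logderiv finite_dirichlet_characters N) auto
    also have "(\<Sum>\<chi>\<in>?X. dirichlet_series (\<lambda>n. \<chi> n * mangoldt n) x) =
        (\<Sum>\<chi>\<in>?X. \<chi> 1 * dirichlet_series (\<lambda>n. \<chi> n * mangoldt n) x)"
      by (intro sum.cong refl) (simp add: dirichlet_character_Suc_0)
    also have "\<dots> = of_real (c x)"
      unfolding c_def using sum_characters_logderiv[OF N x, of 1 1] by simp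
    finally show ?thesis .
  qed
  have "(norm (P t))\<^sup>2 \<le> (norm (P s))\<^sup>2"
  proof (rule DERIV_nonpos_imp_nonincreasing[OF s(2)])
    fix x assume "s \<le> x" "x \<le> t"
    hence x: "x > 1"
      using s by simp
    have "((\<lambda>x. P x \<bullet> P x) has_vector_derivative
        (P x \<bullet> - (of_real (c x) * P x) + - (of_real (c x) * P x) \<bullet> P x)) (at x)"
      using deriv[OF x] by (intro bounded_bilinear.has_vector_derivative[OF bounded_bilinear_inner])
    moreover have "P x \<bullet> - (of_real (c x) * P x) + - (of_real (c x) * P x) \<bullet> P x = - 2 * c x * (P x \<bullet> P x)"
      by (simp add: inner_complex_def algebra_simps)
    ultimately have "DERIV (\<lambda>x. (norm (P x))\<^sup>2) x :> - 2 * c x * (P x \<bullet> P x)"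
      by (simp add: has_real_derivative_iff_has_vector_derivative power2_norm_eq_inner)
    moreover have "c x \<ge> 0"
      using mangoldt_residue_series_nonneg[OF x] by (simp add: c_def)
    ultimately show "\<exists>y. DERIV (\<lambda>x. (norm (P x))\<^sup>2) x :> y \<and> y \<le> 0"
      by (intro exI[of _ "- 2 * c x * (P x \<bullet> P x)"]) auto
  qed
  thus ?thesis
    by (simp add: P_def)
qed

section \<open>Nonvanishing at \<open>1\<close>\<close>

text \<open>The product of all L-series stays away from zero as \<open>s\<close> tends to \<open>1\<close>, but the principal
  one has only a simple pole there; so two of the others cannot both vanish at \<open>1\<close>.\<close>

lemma L_1_zero_unique:
  assumes N: "N > 0"
    and chi: "dirichlet_character N \<chi>" "\<chi> \<noteq> (\<lambda>a. of_bool (coprime a N))" "dirichlet_series \<chi> 1 = 0"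
    and psi: "dirichlet_character N \<psi>" "\<psi> \<noteq> (\<lambda>a. of_bool (coprime a N))" "dirichlet_series \<psi> 1 = 0"
  shows "\<chi> = \<psi>"
proof (rule ccontr)
  assume neq: "\<chi> \<noteq> \<psi>"
  define \<chi>0 :: "nat \<Rightarrow> complex" where "\<chi>0 = (\<lambda>a. of_bool (coprime a N))"
  have chi0: "dirichlet_character N \<chi>0"
    unfolding \<chi>0_def by (rule dirichlet_character_principal)
  let ?X = "{\<chi>. dirichlet_character N \<chi>}"
  define Y where "Y = ?X - {\<chi>0, \<chi>, \<psi>}"
  define C where "C = real (2 * N + 1)"
  define K where "K = (\<Prod>\<xi>\<in>Y. real (2 * N))"
  define c where "c = norm (\<Prod>\<xi>\<in>?X. dirichlet_series \<xi> 3)"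
  have fin: "finite ?X"
    using finite_dirichlet_characters[OF N] .
  have "K \<ge> 0"
    unfolding K_def by (intro prod_nonneg) auto
  \<comment> \<open>At \<open>s = 3\<close> every L-series is within \<open>1 / 2\<close> of
    \<open>1\<close>; monotonicity then carries the lower bound \<open>c\<close> down towards
    \<open>s = 1\<close>.\<close>
  have "dirichlet_series \<xi> 3 \<noteq> 0" if "\<xi> \<in> ?X" for \<xi>
    using norm_L_minus_1_le[OF N, of \<xi> 3] that by auto
  hence "c > 0"
    using fin by (simp add: c_def)
  have bound: "c \<le> 2 * C * C * K * (s - 1)" if s: "1 < s" "s < 2" for s
  proof -
    have X: "?X = insert \<chi>0 (insert \<chi> (insert \<psi> Y))" "finite Y" "\<chi>0 \<notin> insert \<chi> (insert \<psi> Y)"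
      "\<chi> \<notin> insert \<psi> Y" "\<psi> \<notin> Y"
      using chi psi chi0 neq fin by (auto simp: Y_def \<chi>0_def)
    have "c \<le> norm (\<Prod>\<xi>\<in>?X. dirichlet_series \<xi> s)"
      unfolding c_def using s by (intro norm_prod_L_antimono[OF N]) auto
    also have "\<dots> = norm (dirichlet_series \<chi>0 s) * (norm (dirichlet_series \<chi> s) *
        (norm (dirichlet_series \<psi> s) * (\<Prod>\<xi>\<in>Y. norm (dirichlet_series \<xi> s))))"
      using X(2-5) unfolding X(1) by (simp add: norm_mult prod_norm)
    \<comment> \<open>Two factors \<open>C * (s - 1)\<close> stand against one
      \<open>1 / (s - 1)\<close>, so a power of \<open>s - 1\<close> remains and the bound tends to
      \<open>0\<close>.\<close>
    also have "\<dots> \<le> (1 + 1 / (s - 1)) * ((C * (s - 1)) * ((C * (s - 1)) * K))"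
    proof (intro mult_mono)
      show "norm (dirichlet_series \<chi>0 s) \<le> 1 + 1 / (s - 1)"
        using norm_L_le[OF N chi0] s by simp
      show "norm (dirichlet_series \<chi> s) \<le> C * (s - 1)"
        using norm_L_diff_le[OF N chi(1,2) s(1)] chi(3) by (simp add: C_def)
      show "norm (dirichlet_series \<psi> s) \<le> C * (s - 1)"
        using norm_L_diff_le[OF N psi(1,2) s(1)] psi(3) by (simp add: C_def)
      show "(\<Prod>\<xi>\<in>Y. norm (dirichlet_series \<xi> s)) \<le> K"
        unfolding K_def
      proof (rule prod_mono)
        fix \<xi> assume "\<xi> \<in> Y"
        thus "0 \<le> norm (dirichlet_series \<xi> s) \<and> norm (dirichlet_series \<xi> s) \<le> real (2 * N)"
          using norm_nonprincipal_L_le[OF N, of \<xi> s] s by (auto simp: Y_def \<chi>0_def)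
      qed
    qed (use s \<open>K \<ge> 0\<close> in \<open>auto simp: C_def intro!: prod_nonneg mult_nonneg_nonneg\<close>)
    also have "\<dots> = s * (C * C * K * (s - 1))"
      using s by (simp add: field_simps)
    also have "\<dots> \<le> 2 * (C * C * K * (s - 1))"
      using s \<open>K \<ge> 0\<close> by (intro mult_right_mono) (auto simp: C_def)
    finally show ?thesis by (simp add: mult_ac)
  qed
  have ev: "eventually (\<lambda>s :: real. s \<in> {1<..<2}) (at_right 1)"
    by (rule eventually_at_right_real) simp
  have "((\<lambda>s :: real. 2 * C * C * K * (s - 1)) \<longlongrightarrow> 2 * C * C * K * (1 - 1)) (at_right 1)"
    by (intro tendsto_mult tendsto_diff tendsto_const tendsto_ident_at)
  moreover have "eventually (\<lambda>s. c \<le> 2 * C * C * K * (s - 1)) (at_right 1)"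
    using ev
  proof eventually_elim
    case (elim s)
    thus ?case
      using bound[of s] by simp
  qed
  ultimately have "c \<le> 2 * C * C * K * (1 - 1)"
    by (rule tendsto_lowerbound) (rule trivial_limit_at_right_real)
  thus False
    using \<open>c > 0\<close> by simp
qed

text \<open>The conjugate character vanishes at \<open>1\<close> together with
  \<open>\<chi>\<close>, so uniqueness forces \<open>\<chi>\<close> to be real, with values in
  \<open>{-1, 0, 1}\<close>.\<close>

lemma L_1_nonzero:
  assumes N: "N > 0"
    and chi: "dirichlet_character N \<chi>" "\<chi> \<noteq> (\<lambda>a. of_bool (coprime a N))"
  shows "dirichlet_series \<chi> 1 \<noteq> 0"
proof
  assume zero: "dirichlet_series \<chi> 1 = 0"
  define \<psi> where "\<psi> = (\<lambda>a. cnj (\<chi> a))"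
  have psi: "dirichlet_character N \<psi>"
    unfolding \<psi>_def using chi(1) by (rule dirichlet_character_cnj)
  have psi_neq: "\<psi> \<noteq> (\<lambda>a. of_bool (coprime a N))"
  proof
    assume "\<psi> = (\<lambda>a. of_bool (coprime a N))"
    hence "cnj (\<chi> a) = of_bool (coprime a N)" for a
      by (metis \<psi>_def)
    hence "\<chi> a = of_bool (coprime a N)" for a
      by (metis complex_cnj_cnj complex_cnj_one complex_cnj_zero of_bool_eq(1,2))
    with chi(2) show False by blast
  qed
  have sums: "(\<lambda>n. \<chi> n * of_real (real n powr -1)) sums 0"
    using L_sums[OF N chi, of 1] zero by simp
  hence "(\<lambda>n. cnj (\<chi> n * of_real (real n powr -1))) sums cnj 0"
    by (subst sums_cnj)
  hence "dirichlet_series \<psi> 1 = 0"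
    by (simp add: dirichlet_series_def \<psi>_def sums_iff)
  with L_1_zero_unique[OF N chi zero psi psi_neq] have "\<chi> = \<psi>"
    by blast
  hence real: "\<chi> a = of_real (Re (\<chi> a))" for a
    by (metis \<psi>_def complex_is_Real_iff Reals_cnj_iff of_real_Re)
  define c where "c = (\<lambda>a. Re (\<chi> a))"
  have "(0 :: real) \<noteq> 0"
  proof (rule real_character_sum_nonzero[of c])
    show "c (a * b) = c a * c b" for a b
      using dirichlet_character_mult[OF chi(1), of a b] real[of a] real[of b]
      unfolding c_def by (metis Re_complex_of_real of_real_mult)
    show "c 1 = 1"
      using dirichlet_character_1[OF chi(1)] by (simp add: c_def)
    show "c a \<in> {-1, 0, 1}" for a
    proof -
      have "\<bar>c a\<bar> = of_bool (coprime a N)"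
        using norm_dirichlet_character[OF chi(1) N, of a] real[of a]
        unfolding c_def by (metis norm_of_real)
      thus ?thesis
        by (cases "coprime a N") (auto simp: abs_if split: if_splits)
    qed
    show "\<bar>\<Sum>i=m..<n. c i\<bar> \<le> 2 * N" for m n
      using norm_sum_dirichlet_character_le[OF N chi, of m n]
        abs_Re_le_cmod[of "\<Sum>i=m..<n. \<chi> i"] by (simp add: c_def)
    show "(\<lambda>n. c n / real n) sums 0"
      using sums_Re[OF sums[unfolded powr_nat_neg_one]] by (simp add: c_def)
  qed
  thus False by simp
qed

text \<open>For \<open>s\<close> within \<open>l / (2 * C)\<close> of \<open>1\<close>, the
  Lipschitz bound leaves the L-series at least half of its nonzero size at \<open>1\<close>; the
  derivative is bounded by \<open>C\<close>.\<close>

lemma nonprincipal_logderiv_bounded: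
  assumes N: "N > 0"
    and chi: "dirichlet_character N \<chi>" "\<chi> \<noteq> (\<lambda>a. of_bool (coprime a N))"
  obtains K where "\<forall>\<^sub>F s in at_right 1. norm (dirichlet_series (\<lambda>n. \<chi> n * mangoldt n) s) \<le> K"
proof -
  define C where "C = real (2 * N + 1)"
  define l where "l = norm (dirichlet_series \<chi> 1)"
  have l: "l > 0"
    using L_1_nonzero[OF assms] by (simp add: l_def)
  have C: "C > 0"
    by (simp add: C_def)
  have ev: "eventually (\<lambda>s :: real. s \<in> {1<..<1 + l / (2 * C)}) (at_right 1)"
    using l C by (intro eventually_at_right_real) auto
  have "\<forall>\<^sub>F s in at_right 1. norm (dirichlet_series (\<lambda>n. \<chi> n * mangoldt n) s) \<le> 2 * C / l"
    using ev
  proof eventually_elim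
    case (elim s)
    hence s: "s > 1"
      by simp
    have "norm (dirichlet_series \<chi> s - dirichlet_series \<chi> 1) \<le> C * (s - 1)"
      using norm_L_diff_le[OF N chi s] by (simp add: C_def)
    also have "\<dots> \<le> l / 2"
      using elim C by (simp add: field_simps)
    finally have "l / 2 \<le> norm (dirichlet_series \<chi> s)"
      using norm_triangle_ineq2[of "dirichlet_series \<chi> 1" "dirichlet_series \<chi> s"]
      unfolding l_def by (simp add: norm_minus_commute)
    hence "l / 2 * norm (dirichlet_series (\<lambda>n. \<chi> n * mangoldt n) s) \<le>
        norm (dirichlet_series \<chi> s * dirichlet_series (\<lambda>n. \<chi> n * mangoldt n) s)"
      unfolding norm_mult by (intro mult_right_mono) auto
    also have "\<dots> \<le> C"
      unfolding L_times_logderiv[OF N chi(1) s] C_def using norm_deriv_L_le[OF N chi s] by simp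
    finally show ?case
      using l by (simp add: field_simps)
  qed
  thus ?thesis
    by (rule that)
qed

section \<open>Dirichlet's theorem\<close>

text \<open>Under a bound \<open>K\<close>, the sum of \<open>ln n * n powr -s\<close> over
  \<open>n\<close> coprime to \<open>N\<close> is at most \<open>K\<close> times that of
  \<open>n powr -s\<close>. As \<open>ln n\<close> eventually exceeds \<open>K + 1\<close>, the
  latter stays bounded near \<open>s = 1\<close>, against the divergence of the harmonic
  series.\<close>

lemma principal_logderiv_unbounded:
  assumes N: "N > 0"
  defines "F \<equiv> dirichlet_series (\<lambda>n. of_bool (coprime n N) * mangoldt n)"
  shows "\<not> (\<forall>\<^sub>F s in at_right 1. norm (F s) \<le> K)"
proof
  assume bdd: "\<forall>\<^sub>F s in at_right 1. norm (F s) \<le> K"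
  define \<chi> :: "nat \<Rightarrow> complex" where "\<chi> = (\<lambda>a. of_bool (coprime a N))"
  have chi: "dirichlet_character N \<chi>"
    unfolding \<chi>_def by (rule dirichlet_character_principal)
  have of_bool_simps: "norm (of_bool b :: complex) = of_bool b" "of_real (of_bool b) = (of_bool b :: complex)" for b
    by (cases b; simp)+
  \<comment> \<open>From \<open>M\<close> on the logarithm is at least \<open>K + 1\<close>;
    \<open>R\<close> absorbs the first \<open>M\<close> terms, each at least
    \<open>- \<bar>K + 1\<bar>\<close>.\<close>
  obtain M :: nat where M: "real M \<ge> exp (K + 1)"
    using real_arch_simple by blast
  define R where "R = \<bar>K + 1\<bar> * M"
  have ln_ge: "ln (real n) \<ge> K + 1" if "n \<ge> M" for n
  proof -
    have "real n \<ge> exp (K + 1)"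
      using M that by linarith
    thus ?thesis
      by (metis exp_gt_zero ln_exp ln_mono order_less_le_trans)
  qed
  have le: "(\<Sum>n\<in>I. real n powr -s) \<le> R"
    if s: "s > 1" "norm (F s) \<le> K" and I: "finite I" "\<And>n. n \<in> I \<Longrightarrow> coprime n N" for I s
  proof -
    define u where "u = (\<lambda>n. of_bool (coprime n N) * real n powr -s)"
    define v where "v = (\<lambda>n. of_bool (coprime n N) * ln (real n) * real n powr -s)"
    have u: "summable u" 
      using summable_norm_L[OF N chi s(1)] by (simp add: u_def \<chi>_def norm_mult of_bool_simps)
    have "summable (\<lambda>n. norm (v n))"
      using summable_norm_deriv_L[OF N chi s(1)]
      by (simp add: v_def \<chi>_def norm_mult abs_mult of_bool_simps)
    hence v: "summable v"
      by (rule summable_norm_cancel)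
    have u_ge: "(\<Sum>n\<in>I. real n powr -s) \<le> suminf u"
      using sum_le_suminf[OF u, of I] I by (simp add: u_def)
    have "dirichlet_series \<chi> s = of_real (suminf u)"
      using suminf_of_real[OF u, where ?'a = complex] by (simp add: dirichlet_series_def u_def \<chi>_def of_bool_simps)
    moreover have "dirichlet_series (\<lambda>n. \<chi> n * of_real (ln (real n))) s = of_real (suminf v)"
      using suminf_of_real[OF v, where ?'a = complex] by (simp add: dirichlet_series_def v_def \<chi>_def of_bool_simps)
    ultimately have "of_real (suminf v) = of_real (suminf u) * F s"
      using L_times_logderiv[OF N chi s(1)] by (simp add: F_def \<chi>_def)
    hence "norm (of_real (suminf v) :: complex) = norm (of_real (suminf u) * F s)"
      by simp
    hence "\<bar>suminf v\<bar> = \<bar>suminf u\<bar> * norm (F s)"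
      by (simp add: norm_mult)
    moreover have "suminf u \<ge> 0"
      by (intro suminf_nonneg u) (simp add: u_def)
    ultimately have "suminf v \<le> K * suminf u"
      using mult_left_mono[OF s(2), of "suminf u"] by (simp add: mult.commute)
    moreover have "- R \<le> suminf v - (K + 1) * suminf u"
    proof -
      have sm: "summable (\<lambda>n. v n - (K + 1) * u n)"
        by (intro summable_diff summable_mult u v)
      have "- R = (\<Sum>n<M. - \<bar>K + 1\<bar>)"
        by (simp add: R_def)
      also have "\<dots> \<le> (\<Sum>n<M. v n - (K + 1) * u n)"
      proof (rule sum_mono)
        fix n
        have "v n \<ge> 0"
          by (cases "n = 0") (auto simp: v_def)
        have "\<bar>u n\<bar> \<le> 1"
          using s powr_mono[of "-s" 0 "real n"] by (cases "n = 0") (auto simp: u_def)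
        hence "\<bar>(K + 1) * u n\<bar> \<le> \<bar>K + 1\<bar> * 1"
          unfolding abs_mult by (intro mult_left_mono) auto
        with \<open>v n \<ge> 0\<close> show "- \<bar>K + 1\<bar> \<le> v n - (K + 1) * u n"
          by simp
      qed
      also have "\<dots> \<le> (\<Sum>n. v n - (K + 1) * u n)"
      proof (rule sum_le_suminf[OF sm])
        fix n assume "n \<in> - {..<M}"
        hence "(K + 1) * u n \<le> ln (real n) * u n"
          using ln_ge[of n] by (intro mult_right_mono) (auto simp: u_def)
        thus "0 \<le> v n - (K + 1) * u n"
          by (simp add: u_def v_def mult_ac)
      qed simp
      also have "\<dots> = suminf v - (K + 1) * suminf u"
        using suminf_diff[OF v summable_mult[OF u]] suminf_mult[OF u] by simp
      finally show ?thesis .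
    qed
    ultimately have "suminf u \<le> R"
      by (simp add: algebra_simps)
    with u_ge show ?thesis
      by simp
  qed
  \<comment> \<open>The numbers \<open>j * N + 1\<close> are coprime to \<open>N\<close>. Letting
    \<open>s\<close> tend to \<open>1\<close> in finite sums bounds their reciprocals, while
    \<open>j * N + 1 \<le> N * Suc j\<close> compares these with the harmonic series.\<close>
  have harmonic: "(\<Sum>j<J. 1 / real (j * N + 1)) \<le> R" for J
  proof -
    have "inj (\<lambda>j. j * N + 1)"
      using N by (auto simp: inj_on_def)
    have cop: "coprime (j * N + 1) N" for j
      using gcd_add_mult[of N j 1] unfolding coprime_iff_gcd_eq_1 gcd.commute[of "j * N + 1"] by simp
    have "eventually (\<lambda>s :: real. s > 1) (at_right 1)"
      by (simp add: eventually_at_right_less)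
    with bdd have ev: "\<forall>\<^sub>F s in at_right 1. (\<Sum>j<J. real (j * N + 1) powr -s) \<le> R"
    proof eventually_elim
      case (elim s)
      have "(\<Sum>n\<in>(\<lambda>j. j * N + 1) ` {..<J}. real n powr -s) \<le> R"
        using elim cop by (intro le) auto
      also have "(\<Sum>n\<in>(\<lambda>j. j * N + 1) ` {..<J}. real n powr -s) =
          (\<Sum>j<J. real (j * N + 1) powr -s)"
        by (rule sum.reindex[OF inj_on_subset[OF \<open>inj _\<close>], unfolded o_def]) simp
      finally show ?case .
    qed
    have nz: "real (j * N + 1) \<noteq> 0" for j
      by (simp only: of_nat_eq_0_iff)
    have lim: "((\<lambda>s. \<Sum>j<J. real (j * N + 1) powr -s) \<longlongrightarrow>
        (\<Sum>j<J. real (j * N + 1) powr -1)) (at_right 1)"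
      by (intro tendsto_sum tendsto_powr tendsto_const tendsto_minus tendsto_ident_at nz)
    have "(\<Sum>j<J. real (j * N + 1) powr -1) \<le> R"
      by (rule tendsto_upperbound[OF lim ev]) (rule trivial_limit_at_right_real)
    thus ?thesis
      by (simp only: powr_nat_neg_one)
  qed
  have "summable (\<lambda>j. 1 / real (j * N + 1))"
    by (rule summableI_nonneg_bounded[OF _ harmonic]) simp
  hence "summable (\<lambda>j. real N * (1 / real (j * N + 1)))"
    by (rule summable_mult)
  hence "summable (\<lambda>j. real (Suc j) powr -1)"
  proof (rule summable_comparison_test')
    fix j :: nat
    have *: "1 / c \<le> n * (1 / a)" if "a \<le> n * c" "0 < a" "0 < c" for a c n :: real
      using that by (simp add: field_simps)
    have "j * N + 1 \<le> N * Suc j"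
      using N by simp
    hence "real (j * N + 1) \<le> real N * real (Suc j)"
      by (metis of_nat_le_iff of_nat_mult)
    moreover have "0 < real (j * N + 1)" "0 < real (Suc j)"
      by (simp_all only: of_nat_0_less_iff)
    ultimately have "1 / real (Suc j) \<le> real N * (1 / real (j * N + 1))"
      by (rule *)
    thus "norm (real (Suc j) powr -1) \<le> real N * (1 / real (j * N + 1))"
      unfolding powr_nat_neg_one by simp
  qed
  hence "summable (\<lambda>j. real j powr -1)"
    by (subst (asm) summable_Suc_iff)
  thus False
    using summable_real_powr_iff[of "-1"] by simp
qed

text \<open>Only prime powers with exponent at least \<open>2\<close> contribute. For fixed
  \<open>p\<close> the geometric series with ratio at most \<open>1 / 2\<close> gives
  \<open>2 * ln p / p^2\<close>, which is summable over \<open>p\<close>.\<close>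

lemma summable_mangoldt_nonprime: "summable (\<lambda>n. of_bool (\<not> prime n) * mangoldt n / real n)"
proof (rule summableI_nonneg_bounded)
  define C where "C = (\<Sum>n. ln (real n) * real n powr -2)"
  show "0 \<le> of_bool (\<not> prime n) * mangoldt n / real n" for n :: nat
    by (simp add: mangoldt_nonneg)
  fix m :: nat
  define Q where "Q = {n. n < m \<and> primepow n \<and> \<not> prime n}"
  define A where "A = {p. p < m \<and> prime p}"
  \<comment> \<open>Both \<open>p\<close> and \<open>k\<close> are at most \<open>p ^ k\<close>, so
    \<open>n < m\<close> confines the pairs to a finite rectangle.\<close>
  have Q: "Q \<subseteq> (\<lambda>(p, k). p ^ k) ` (A \<times> {2..m})"
  proof
    fix n assume "n \<in> Q"
    then obtain p k where n: "n = p ^ k" "prime p" "k > 0" "n < m" "\<not> prime n"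
      by (auto simp: Q_def primepow_def)
    have "k \<noteq> 1"
      using n by auto
    have "k < p ^ k" "p \<le> p ^ k"
      using n prime_gt_1_nat[of p] by (auto intro: power_gt_expt self_le_power)
    thus "n \<in> (\<lambda>(p, k). p ^ k) ` (A \<times> {2..m})"
      using n \<open>k \<noteq> 1\<close> by (intro image_eqI[of _ _ "(p, k)"]) (auto simp: A_def)
  qed
  have "(\<Sum>n<m. of_bool (\<not> prime n) * mangoldt n / real n) = (\<Sum>n\<in>Q. mangoldt n / real n)"
    unfolding Q_def by (intro sum.mono_neutral_cong_right) (auto simp: mangoldt_def)
  also have "\<dots> \<le> (\<Sum>n\<in>(\<lambda>(p, k). p ^ k) ` (A \<times> {2..m}). mangoldt n / real n)"
    using Q by (intro sum_mono2) (auto simp: A_def mangoldt_nonneg)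
  also have "\<dots> \<le> (\<Sum>x\<in>A \<times> {2..m}. ((\<lambda>n. mangoldt n / real n) \<circ> (\<lambda>(p, k). p ^ k)) x)"
    by (intro sum_image_le) (auto simp: A_def mangoldt_nonneg)
  also have "\<dots> = (\<Sum>p\<in>A. \<Sum>k=2..m. ln (real p) * (1 / real p) ^ k)"
    by (subst sum.cartesian_product) (auto intro!: sum.cong simp: A_def power_one_over field_simps)
  also have "\<dots> \<le> (\<Sum>p\<in>A. 2 * (ln (real p) * real p powr -2))"
  proof (rule sum_mono)
    fix p assume "p \<in> A"
    hence p: "p \<ge> 2"
      by (auto simp: A_def prime_ge_2_nat)
    define x where "x = 1 / real p"
    have x: "0 < x" "x \<le> 1 / 2"
      using p by (auto simp: x_def field_simps)
    have "(\<Sum>k=2..m. x ^ k) \<le> 2 * x\<^sup>2"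
    proof (cases "2 \<le> m")
      case True
      have "(1 - x) * (\<Sum>k=2..m. x ^ k) = x\<^sup>2 - x ^ Suc m"
        using True sum_gp_multiplied[of 2 m x] by simp
      also have "\<dots> \<le> x\<^sup>2"
        using x by simp
      finally have "(1 - x) * (\<Sum>k=2..m. x ^ k) \<le> x\<^sup>2" .
      moreover have "1 / 2 * (\<Sum>k=2..m. x ^ k) \<le> (1 - x) * (\<Sum>k=2..m. x ^ k)"
        using x by (intro mult_right_mono sum_nonneg) auto
      ultimately show ?thesis
        by simp
    qed (use x in auto)
    hence "ln (real p) * (\<Sum>k=2..m. x ^ k) \<le> ln (real p) * (2 * x\<^sup>2)"
      using p by (intro mult_left_mono) auto
    also have "x\<^sup>2 = real p powr -2"
      using p by (simp add: x_def powr_minus power_one_over inverse_eq_divide)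
    finally show "(\<Sum>k=2..m. ln (real p) * (1 / real p) ^ k) \<le> 2 * (ln (real p) * real p powr -2)"
      by (simp add: x_def sum_distrib_left mult_ac)
  qed
  also have "\<dots> = 2 * (\<Sum>p\<in>A. ln (real p) * real p powr -2)"
    by (simp add: sum_distrib_left)
  also have "(\<Sum>p\<in>A. ln (real p) * real p powr -2) \<le> C"
    unfolding C_def
  proof (rule sum_le_suminf)
    show "summable (\<lambda>n. ln (real n) * real n powr -2)"
      by (rule summable_ln_powr) simp
    show "0 \<le> ln (real n) * real n powr -2" for n
      by (cases "n = 0") auto
  qed (simp add: A_def)
  finally show "(\<Sum>n<m. of_bool (\<not> prime n) * mangoldt n / real n) \<le> 2 * C"
    by simp
qed

text \<open>With finitely many primes in the class, its Mangoldt series is bounded for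
  \<open>s > 1\<close>. As the nonprincipal terms of the orthogonality formula are bounded near
  \<open>1\<close>, the principal one would be bounded as well.\<close>

theorem Dirichlet_primes_in_residue_class:
  fixes N b :: nat
  assumes N: "N > 0" and "coprime b N"
  shows "infinite {p. prime p \<and> [p = b] (mod N)}"
proof
  assume fin: "finite {p. prime p \<and> [p = b] (mod N)}"
  obtain b' where b': "[b * b' = 1] (mod N)"
    using cong_solve_coprime_nat[OF assms(2)] by auto
  define F where "F = (\<lambda>\<chi>. dirichlet_series (\<lambda>n. \<chi> n * mangoldt n))"
  define \<chi>0 :: "nat \<Rightarrow> complex" where "\<chi>0 = (\<lambda>a. of_bool (coprime a N))"
  let ?X = "{\<chi>. dirichlet_character N \<chi>}"
  have finX: "finite ?X"
    using finite_dirichlet_characters[OF N] .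
  have chi0: "\<chi>0 \<in> ?X"
    unfolding \<chi>0_def using dirichlet_character_principal by blast
  have "coprime b' N"
    using b' by (metis coprime_mult_left_iff cong_imp_coprime cong_sym coprime_1_left)
  \<comment> \<open>For primes the weight \<open>n powr -s\<close> is estimated by \<open>1\<close>,
    as only finitely many occur in the class; for other \<open>n\<close> it is estimated by
    \<open>1 / n\<close>.\<close>
  define R1 where "R1 = (\<Sum>n. of_bool (prime n \<and> [n = b] (mod N)) * mangoldt n :: real)"
  define R2 where "R2 = (\<Sum>n. of_bool (\<not> prime n) * mangoldt n / real n)"
  have sm1: "summable (\<lambda>n. of_bool (prime n \<and> [n = b] (mod N)) * mangoldt n :: real)"
    using fin by (intro summable_finite) auto
  have le: "mangoldt_residue_series N b s \<le> R1 + R2" if s: "s > 1" for s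
  proof -
    have "mangoldt_residue_series N b s \<le>
        (\<Sum>n. of_bool (prime n \<and> [n = b] (mod N)) * mangoldt n + of_bool (\<not> prime n) * mangoldt n / real n)"
      unfolding mangoldt_residue_series_def
    proof (intro suminf_le summable_add sm1 summable_mangoldt_nonprime summable_mangoldt_residue_series s)
      fix n :: nat
      show "of_bool ([n = b] (mod N)) * mangoldt n * real n powr -s \<le>
          of_bool (prime n \<and> [n = b] (mod N)) * mangoldt n + of_bool (\<not> prime n) * mangoldt n / real n"
      proof (cases "n = 0")
        case False
        have "real n powr -s \<le> real n powr -1"
          using False s by (intro powr_mono) auto
        hence 1: "mangoldt n * real n powr -s \<le> mangoldt n / real n"
          using False mult_left_mono[OF _ mangoldt_nonneg, of "real n powr -s" "1 / real n" n]
          by (simp add: powr_minus divide_inverse)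
        have "real n powr -s \<le> 1"
          using False s powr_mono[of "-s" 0 "real n"] by simp
        hence 2: "mangoldt n * real n powr -s \<le> mangoldt n"
          using mult_left_mono[OF _ mangoldt_nonneg, of "real n powr -s" 1 n] by simp
        show ?thesis
          using 1 2 mangoldt_nonneg[of n] by auto
      qed simp
    qed
    also have "\<dots> = R1 + R2"
      unfolding R1_def R2_def by (intro suminf_add[symmetric] sm1 summable_mangoldt_nonprime)
    finally show ?thesis .
  qed
  have "\<exists>K. \<forall>\<^sub>F s in at_right 1. norm (F \<chi> s) \<le> K" if "\<chi> \<in> ?X - {\<chi>0}" for \<chi>
    using nonprincipal_logderiv_bounded[OF N, of \<chi>] that unfolding F_def \<chi>0_def by blast
  then obtain K where K: "\<And>\<chi>. \<chi> \<in> ?X - {\<chi>0} \<Longrightarrow> \<forall>\<^sub>F s in at_right 1. norm (F \<chi> s) \<le> K \<chi>"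
    by metis
  have "\<forall>\<^sub>F s in at_right 1. \<forall>\<chi>\<in>?X - {\<chi>0}. norm (F \<chi> s) \<le> K \<chi>"
    using finX K by (intro eventually_ball_finite) auto
  moreover have "eventually (\<lambda>s :: real. s > 1) (at_right 1)"
    by (simp add: eventually_at_right_less)
  ultimately have "\<forall>\<^sub>F s in at_right 1. norm (F \<chi>0 s) \<le> real (card ?X) * (R1 + R2) + (\<Sum>\<chi>\<in>?X - {\<chi>0}. K \<chi>)"
  proof eventually_elim
    case (elim s)
    have "\<chi>0 b' * F \<chi>0 s + (\<Sum>\<chi>\<in>?X - {\<chi>0}. \<chi> b' * F \<chi> s) = (\<Sum>\<chi>\<in>?X. \<chi> b' * F \<chi> s)"
      using finX chi0 by (rule sum.remove[symmetric])
    also have "\<dots> = of_real (real (card ?X) * mangoldt_residue_series N b s)"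
      unfolding F_def using elim b' by (intro sum_characters_logderiv[OF N]) auto
    \<comment> \<open>Coprimality of \<open>b'\<close> gives \<open>\<chi>0 b' = 1\<close>, which
      isolates the principal term.\<close>
    finally have "F \<chi>0 s = of_real (real (card ?X) * mangoldt_residue_series N b s) -
        (\<Sum>\<chi>\<in>?X - {\<chi>0}. \<chi> b' * F \<chi> s)"
      using \<open>coprime b' N\<close> by (simp add: \<chi>0_def algebra_simps)
    also have "norm \<dots> \<le> norm (of_real (real (card ?X) * mangoldt_residue_series N b s) :: complex) +
        norm (\<Sum>\<chi>\<in>?X - {\<chi>0}. \<chi> b' * F \<chi> s)"
      by (rule norm_triangle_ineq4)
    also have "\<dots> \<le> real (card ?X) * (R1 + R2) + (\<Sum>\<chi>\<in>?X - {\<chi>0}. K \<chi>)"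
    proof (rule add_mono)
      have "norm (of_real (real (card ?X) * mangoldt_residue_series N b s) :: complex) =
          real (card ?X) * mangoldt_residue_series N b s"
        using mangoldt_residue_series_nonneg[of s N b] elim by (simp only: norm_of_real) simp
      also have "\<dots> \<le> real (card ?X) * (R1 + R2)"
        using le elim by (intro mult_left_mono) auto
      finally show "norm (of_real (real (card ?X) * mangoldt_residue_series N b s) :: complex) \<le>
          real (card ?X) * (R1 + R2)" .
      show "norm (\<Sum>\<chi>\<in>?X - {\<chi>0}. \<chi> b' * F \<chi> s) \<le> (\<Sum>\<chi>\<in>?X - {\<chi>0}. K \<chi>)"
      proof (rule sum_norm_le)
        fix \<chi> assume chi: "\<chi> \<in> ?X - {\<chi>0}"
        have "norm (\<chi> b' * F \<chi> s) \<le> 1 * norm (F \<chi> s)"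
          unfolding norm_mult using chi
          by (intro mult_right_mono norm_dirichlet_character_le[OF _ N]) auto
        also have "\<dots> \<le> K \<chi>"
          using elim chi by simp
        finally show "norm (\<chi> b' * F \<chi> s) \<le> K \<chi>" .
      qed
    qed
    finally show ?case .
  qed
  thus False
    using principal_logderiv_unbounded[OF N] unfolding F_def \<chi>0_def by blast
qed

section \<open>The covering system\<close>

text \<open>With \<open>n = q * m + r\<close>, the number \<open>k * 2 ^ n\<close> is congruent to
  \<open>k * 2 ^ r\<close>, hence to \<open>1\<close>, modulo \<open>d\<close>. The gap
  \<open>d + 1 < k\<close> makes \<open>d\<close> a proper divisor.\<close>

lemma composite_of_covering:
  fixes k d q r n :: nat
  assumes "d > 1" "d + 1 < k" "[k * 2 ^ r = 1] (mod d)" "[2 ^ q = 1] (mod d)" "n mod q = r"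
  shows "composite (k * 2 ^ n - 1)"
proof -
  have "n = q * (n div q) + r"
    using assms(5) by (metis mult_div_mod_eq)
  hence "k * 2 ^ n = k * 2 ^ r * (2 ^ q) ^ (n div q)"
    by (metis mult.assoc mult.commute power_add power_mult)
  moreover have "[k * 2 ^ r * (2 ^ q) ^ (n div q) = 1 * 1 ^ (n div q)] (mod d)"
    using assms by (intro cong_mult cong_pow)
  ultimately have cong: "[k * 2 ^ n = 1] (mod d)"
    by (simp only: mult_1 power_one)
  have "k * 1 \<le> k * 2 ^ n"
    by (intro mult_le_mono) auto
  hence large: "d < k * 2 ^ n - 1" "1 \<le> k * 2 ^ n"
    using assms(2) by linarith+
  have "d dvd k * 2 ^ n - 1"
    using cong large(2) by (simp add: cong_altdef_nat)
  hence "\<not> prime (k * 2 ^ n - 1)"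
    using large(1) \<open>d > 1\<close> by (metis less_irrefl prime_nat_iff)
  thus ?thesis
    using large(1) \<open>d > 1\<close> by (simp add: composite_def)
qed

text \<open>Triples \<open>(q, r, d)\<close>: the modulus \<open>d\<close> divides \<open>k * 2 ^ n - 1\<close> whenever \<open>n mod q = r\<close>.\<close>

definition riesel_cover :: "(nat \<times> nat \<times> nat) list" where
  "riesel_cover =
    [(2, 1, 3), (3, 0, 7), (5, 0, 31), (10, 2, 11), (15, 1, 151), (20, 8, 41), (30, 4, 331),
     (40, 18, 61681), (45, 11, 631), (45, 26, 23311), (60, 14, 61), (60, 44, 1321),
     (80, 38, 4278255361), (90, 86, 18837001), (160, 78, 414721), (160, 158, 44479210368001)]"

text \<open>The common period of the classes is \<open>1440\<close>. The check runs modulo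
  \<open>60\<close> with two coarser classes: \<open>18\<close> modulo \<open>20\<close> is then
  refined by doubling up to \<open>160\<close>, and \<open>26\<close> modulo \<open>30\<close> by
  tripling to \<open>90\<close>.\<close>

lemma riesel_cover_complete: "\<exists>(q, r, d)\<in>set riesel_cover. n mod q = r"
proof -
  have double: "n mod (a * 2) = n mod a \<or> n mod (a * 2) = a + n mod a" for a
    using mod_mult2_eq[of n a 2] by (cases "even (n div a)") (simp_all add: odd_iff_mod_2_eq_one)
  have "\<forall>x\<in>{..<60}. x mod 2 = 1 \<or> x mod 3 = 0 \<or> x mod 5 = 0 \<or> x mod 10 = 2 \<or> x mod 15 = 1 \<or>
      x mod 20 = 8 \<or> x mod 20 = 18 \<or> x mod 30 = 4 \<or> x mod 30 = 26 \<or> x mod 60 = 14 \<or> x mod 60 = (44::nat)"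
    by (simp add: lessThan_nat_numeral lessThan_Suc)
  from bspec[OF this, of "n mod 60"]
  have "n mod 2 = 1 \<or> n mod 3 = 0 \<or> n mod 5 = 0 \<or> n mod 10 = 2 \<or> n mod 15 = 1 \<or>
      n mod 20 = 8 \<or> n mod 20 = 18 \<or> n mod 30 = 4 \<or> n mod 30 = 26 \<or> n mod 60 = 14 \<or> n mod 60 = 44"
    by (simp add: mod_mod_cancel)
  moreover have "n mod 20 = 18 \<Longrightarrow> n mod 40 = 18 \<or> n mod 40 = 38"
    and "n mod 40 = 38 \<Longrightarrow> n mod 80 = 38 \<or> n mod 80 = 78"
    and "n mod 80 = 78 \<Longrightarrow> n mod 160 = 78 \<or> n mod 160 = 158"
    using double[of 20] double[of 40] double[of 80] by auto
  moreover have "n mod 45 = 26 \<or> n mod 45 = 11 \<or> n mod 90 = 86" if "n mod 30 = 26"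
  proof -
    have "n div 30 mod 3 = 0 \<or> n div 30 mod 3 = 1 \<or> n div 30 mod 3 = 2"
      by linarith
    hence "n mod 90 = 26 \<or> n mod 90 = 56 \<or> n mod 90 = 86"
      using mod_mult2_eq[of n 30 3] that by auto
    moreover have "n mod 90 mod 45 = n mod 45"
      by (simp add: mod_mod_cancel)
    ultimately show ?thesis
      by auto
  qed
  ultimately show ?thesis
    unfolding riesel_cover_def list.set bex_simps case_prod_conv by argo
qed

definition riesel_modulus :: nat where
  "riesel_modulus = 3189762509404991434026267111935081578564848099075598418737381122"

definition riesel_residue :: nat where
  "riesel_residue = 1464481329052452484012410951111069258728979724777952402192519099"

lemma riesel_cover_divisors:
  assumes "(q, r, d) \<in> set riesel_cover"
  shows "1 < d" "d + 1 < riesel_residue" "d dvd riesel_modulus"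
    "[riesel_residue * 2 ^ r = 1] (mod d)" "[2 ^ q = 1] (mod d)"
proof -
  \<comment> \<open>The evaluation takes place over \<open>int\<close>, where numbers are
    represented in binary, and is carried back to \<open>nat\<close> afterwards.\<close>
  have *: "\<forall>(q, r, d)\<in>set (map (\<lambda>(q, r, d). (q, r, int d)) riesel_cover).
      1 < d \<and> d + 1 < 1464481329052452484012410951111069258728979724777952402192519099 \<and>
      3189762509404991434026267111935081578564848099075598418737381122 mod d = 0 \<and>
      1464481329052452484012410951111069258728979724777952402192519099 * 2 ^ r mod d = 1 \<and>
      2 ^ q mod d = 1"
    unfolding riesel_cover_def list.map case_prod_conv of_nat_numeral by code_simp
  have "1 < int d" "int d + 1 < int riesel_residue" "int riesel_modulus mod int d = 0"
    "int riesel_residue * 2 ^ r mod int d = 1" "2 ^ q mod int d = 1"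
    using bspec[OF *, of "(q, r, int d)"] assms
    by (force simp: riesel_residue_def riesel_modulus_def)+
  thus "1 < d" "d + 1 < riesel_residue" "d dvd riesel_modulus"
    "[riesel_residue * 2 ^ r = 1] (mod d)" "[2 ^ q = 1] (mod d)"
    by (simp_all flip: cong_int_iff add: cong_def mod_0_imp_dvd)
       (metis mod_0_imp_dvd of_nat_dvd_iff)
qed

theorem corollary2:
  fixes A B :: nat
  assumes "A = 3189762509404991434026267111935081578564848099075598418737381122"
    and "B = 1464481329052452484012410951111069258728979724777952402192519099"
  shows "infinite {p. (\<exists>m::nat. p = A * m + B) \<and> prime p \<and> riesel p}"
proof -
  have AB: "A = riesel_modulus" "B = riesel_residue"
    using assms by (simp_all add: riesel_modulus_def riesel_residue_def)
  have "gcd (1464481329052452484012410951111069258728979724777952402192519099 :: int)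
      3189762509404991434026267111935081578564848099075598418737381122 = 1"
    by code_simp
  hence "gcd (int B) (int A) = 1"
    using assms by simp
  hence "coprime B A"
    by (simp only: gcd_int_int_eq of_nat_eq_1_iff coprime_iff_gcd_eq_1)
  moreover have "A > 0" "B < A" "even A" "odd B"
    using assms by simp_all
  ultimately have "infinite {p. prime p \<and> [p = B] (mod A)}"
    by (intro Dirichlet_primes_in_residue_class)
  moreover have "{p. prime p \<and> [p = B] (mod A)} \<subseteq> {p. (\<exists>m. p = A * m + B) \<and> prime p \<and> riesel p}"
  proof safe
    fix p :: nat
    assume "prime p" and p: "[p = B] (mod A)"
    \<comment> \<open>\<open>B < A\<close> excludes members of the class below \<open>B\<close>, so
      \<open>p div A\<close> is a witness for \<open>m\<close>.\<close>
    have "p mod A = B"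
      using p \<open>B < A\<close> by (simp add: cong_def)
    hence eq: "p = A * (p div A) + B"
      by (metis mult_div_mod_eq)
    thus "\<exists>m. p = A * m + B"
      by blast
    have "p \<ge> B"
      using eq by (metis le_add2)
    have "odd p"
      using eq \<open>even A\<close> \<open>odd B\<close> by (metis dvd_mult2 even_add)
    moreover have "composite (p * 2 ^ n - 1)" for n
    proof -
      obtain q r d where qrd: "(q, r, d) \<in> set riesel_cover" "n mod q = r"
        using riesel_cover_complete[of n] by blast
      note d = riesel_cover_divisors[OF qrd(1)]
      have "[p * 2 ^ r = B * 2 ^ r] (mod d)"
        using cong_dvd_modulus_nat[OF p] d(3) by (intro cong_mult cong_refl) (simp add: AB)
      hence "[p * 2 ^ r = 1] (mod d)"
        using d(4) by (metis AB(2) cong_trans)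
      moreover have "d + 1 < p"
        using d(2) \<open>p \<ge> B\<close> by (simp add: AB)
      ultimately show ?thesis
        using d(1,5) qrd(2) by (intro composite_of_covering)
    qed
    ultimately show "riesel p"
      using \<open>prime p\<close> by (simp add: riesel_def prime_gt_0_nat)
  qed
  ultimately show ?thesis
    by (rule infinite_super[rotated])
qed

end
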